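(* If $X$ is a uniformly locally pathwise connected, connected uniform space, then the pathwise connected component of $\widetilde{X}$ containing the basepoint $*$ is dense in $\widetilde{X}$, and $\lambda(\pi_1(X))$ is dense in $\delta_1(X)$.
   Context: All entourages are taken to be symmetric; $B(x,E)=\{y:(x,y)\in E\}$ is the $E$-ball at $x$. $X$ is uniformly locally pathwise connected if for each entourage $E$ there is an entourage $F\subset E$ such that all $F$-balls are open and pathwise connected. Fix a basepoint $*\in X$. For an entourage $E$ of $X$, an $E$-chain from $p$ to $q$ is a finite sequence $\{x_0=p,\dots,x_n=q\}$ with $(x_i,x_{i+1})\in E$ for all $i$; it is an $E$-loop if $p=q$. Two $E$-chains with the same endpoints are $E$-homotopic if one is obtained from the other in finitely many steps, each adding or removing a single point, always keeping the endpoints fixed and keeping an $E$-chain at each stage (in particular $\{p\}$ and $\{p,p\}$ are $E$-homotopic); $[\alpha]_E$ is the class of $\alpha$. $X_E$ is the set of $E$-homotopy classes of $E$-chains starting at $*$. For an entourage $D\subset E$ let $D^*$ be the set of pairs $([*=x_0,\dots,x_n,y]_E,[*=x_0,\dots,x_n,z]_E)$ with $(y,z)\in D$; $X_E$ carries the uniformity with base $\{D^*:D\subset E\}$. For $F\subset E$, $\phi_{EF}:X_F\to X_E$ is $[\alpha]_F\mapsto[\alpha]_E$. $\widetilde{X}=\varprojlim X_E$ (over all entourages, ordered by reverse inclusion, with the inverse limit uniformity and basepoint $*=([*]_E)_E$), with projection $\phi:\widetilde{X}\to X=X_{X\times X}$. $\delta_E(X)$ is the (discrete) group of $E$-homotopy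 classes of $E$-loops at $*$ under concatenation. $\delta_1(X)=\varprojlim\delta_E(X)$ (bonding maps $[\lambda]_F\mapsto[\lambda]_E$) has the inverse limit topology, which is the same as the subspace topology from $\widetilde{X}$; as a subset of $\widetilde{X}$ it equals $\phi^{-1}( * )$. Every path $c:[0,1]\to X$ with $c(0)=*$ has a unique continuous lift $c_L:[0,1]\to\widetilde{X}$ with $c_L(0)=*$ and $\phi\circ c_L=c$. The natural homomorphism $\lambda:\pi_1(X)=\pi_1(X,* )\to\delta_1(X)$ is $\lambda([c])=c_L(1)\in\phi^{-1}( * )=\delta_1(X)$, which is well defined. *)

theory Defs
  imports "HOL-Analysis.Analysis"
begin

section \<open>Entourages\<close>

definition entourages :: "('a::uniform_space \<times> 'a) set set" where
  "entourages = {E. sym E \<and> eventually (\<lambda>z. z \<in> E) uniformity}"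

definition eball :: "'a \<Rightarrow> ('a \<times> 'a) set \<Rightarrow> 'a set" where
  "eball x E = {y. (x, y) \<in> E}"

definition uniformly_locally_path_connected :: "'a::uniform_space itself \<Rightarrow> bool" where
  "uniformly_locally_path_connected (_ :: 'a itself) \<longleftrightarrow>
     (\<forall>E \<in> (entourages :: ('a \<times> 'a) set set). \<exists>F \<in> entourages. F \<subseteq> E \<and>
        (\<forall>x. open (eball x F) \<and> path_connected (eball x F)))"

section \<open>Chains and their homotopy classes\<close>

definition chain :: "('a \<times> 'a) set \<Rightarrow> 'a list \<Rightarrow> bool" where
  "chain E \<alpha> \<longleftrightarrow> \<alpha> \<noteq> [] \<and> successively (\<lambda>x y. (x, y) \<in> E) \<alpha>"

definition add_point :: "('a \<times> 'a) set \<Rightarrow> 'a list \<Rightarrow> 'a list \<Rightarrow> bool" where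
  "add_point E \<alpha> \<beta> \<longleftrightarrow> chain E \<alpha> \<and> chain E \<beta> \<and> hd \<beta> = hd \<alpha> \<and> last \<beta> = last \<alpha> \<and>
     (\<exists>xs x ys. \<alpha> = xs @ ys \<and> \<beta> = xs @ [x] @ ys)"

text \<open>
  The homotopy relation, as an equivalence relation on the set of all \<open>E\<close>-chains.
  The class \<open>[\<alpha>]\<^sub>E\<close> is the image \<open>chain_homotopy E `` {\<alpha>}\<close>.
\<close>

definition chain_homotopy :: "('a \<times> 'a) set \<Rightarrow> ('a list \<times> 'a list) set" where
  "chain_homotopy E = {(\<alpha>, \<beta>). chain E \<alpha> \<and> chain E \<beta> \<and>
     (\<lambda>\<gamma> \<delta>. add_point E \<gamma> \<delta> \<or> add_point E \<delta> \<gamma>)\<^sup>*\<^sup>* \<alpha> \<beta>}"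

abbreviation chain_class :: "('a \<times> 'a) set \<Rightarrow> 'a list \<Rightarrow> 'a list set" where
  "chain_class E \<alpha> \<equiv> chain_homotopy E `` {\<alpha>}"

definition chain_space :: "'a \<Rightarrow> ('a \<times> 'a) set \<Rightarrow> 'a list set set" where
  "chain_space p E = {\<alpha>. chain E \<alpha> \<and> hd \<alpha> = p} // chain_homotopy E"

definition loop_classes :: "'a \<Rightarrow> ('a \<times> 'a) set \<Rightarrow> 'a list set set" where
  "loop_classes p E = {\<alpha>. chain E \<alpha> \<and> hd \<alpha> = p \<and> last \<alpha> = p} // chain_homotopy E"

text \<open>
  For \<open>F \<subseteq> E\<close> and \<open>C = [\<alpha>]\<^sub>F\<close>, every member of \<open>C\<close> is \<open>E\<close>-homotopic to \<open>\<alpha>\<close>, so that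
  \<open>bond E C = [\<alpha>]\<^sub>E\<close>; the index \<open>F\<close> is not needed.
\<close>

definition bond :: "('a \<times> 'a) set \<Rightarrow> 'a list set \<Rightarrow> 'a list set" where
  "bond E C = chain_homotopy E `` C"

definition star_entourage ::
    "'a \<Rightarrow> ('a \<times> 'a) set \<Rightarrow> ('a \<times> 'a) set \<Rightarrow> ('a list set \<times> 'a list set) set" where
  "star_entourage p E D =
     {(chain_class E (xs @ [y]), chain_class E (xs @ [z])) | xs y z.
        xs \<noteq> [] \<and> hd xs = p \<and> chain E (xs @ [y]) \<and> chain E (xs @ [z]) \<and> (y, z) \<in> D}"

definition chain_space_uniformity ::
    "'a::uniform_space \<Rightarrow> ('a \<times> 'a) set \<Rightarrow> ('a list set \<times> 'a list set) filter" where
  "chain_space_uniformity p E =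
     (INF D \<in> {D \<in> entourages. D \<subseteq> E}. principal (star_entourage p E D))"

section \<open>Inverse limits over the entourages\<close>

definition inverse_limit ::
    "(('a::uniform_space \<times> 'a) set \<Rightarrow> 'a list set set) \<Rightarrow> (('a \<times> 'a) set \<Rightarrow> 'a list set) set" where
  "inverse_limit Y = {u \<in> Pi\<^sub>E entourages Y.
     \<forall>E \<in> entourages. \<forall>F \<in> entourages. F \<subseteq> E \<longrightarrow> bond E (u F) = u E}"

text \<open>
  The topology on a set \<open>S\<close> induced by a uniformity \<open>\<Phi>\<close> on \<open>S\<close>, given as a filter of relations;
  compare the condition on \<open>open\<close> in the class \<^class>\<open>uniform_space\<close>.
\<close>

definition uniform_topology :: "'b set \<Rightarrow> ('b \<times> 'b) filter \<Rightarrow> 'b topology" where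
  "uniform_topology S \<Phi> =
     topology (\<lambda>U. U \<subseteq> S \<and> (\<forall>x\<in>U. eventually (\<lambda>(x', y). x' = x \<longrightarrow> y \<in> U) \<Phi>))"

lemma openin_uniform_topology:
  "openin (uniform_topology S \<Phi>) U \<longleftrightarrow>
     U \<subseteq> S \<and> (\<forall>x\<in>U. eventually (\<lambda>(x', y). x' = x \<longrightarrow> y \<in> U) \<Phi>)"
proof -
  have "istopology (\<lambda>U. U \<subseteq> S \<and> (\<forall>x\<in>U. eventually (\<lambda>(x', y). x' = x \<longrightarrow> y \<in> U) \<Phi>))"
    unfolding istopology_def
  proof (intro conjI allI impI; (elim conjE)?)
    fix U V assume U: "\<forall>x\<in>U. eventually (\<lambda>(x', y). x' = x \<longrightarrow> y \<in> U) \<Phi>"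
      and V: "\<forall>x\<in>V. eventually (\<lambda>(x', y). x' = x \<longrightarrow> y \<in> V) \<Phi>"
    show "\<forall>x\<in>U \<inter> V. eventually (\<lambda>(x', y). x' = x \<longrightarrow> y \<in> U \<inter> V) \<Phi>"
    proof
      fix x assume "x \<in> U \<inter> V"
      then have "eventually (\<lambda>(x', y). x' = x \<longrightarrow> y \<in> U) \<Phi>"
        and "eventually (\<lambda>(x', y). x' = x \<longrightarrow> y \<in> V) \<Phi>"
        using U V by auto
      then show "eventually (\<lambda>(x', y). x' = x \<longrightarrow> y \<in> U \<inter> V) \<Phi>"
        by eventually_elim auto
    qed
  next
    fix \<K> assume K: "\<forall>K\<in>\<K>. K \<subseteq> S \<and> (\<forall>x\<in>K. eventually (\<lambda>(x', y). x' = x \<longrightarrow> y \<in> K) \<Phi>)"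
    show "\<forall>x\<in>\<Union>\<K>. eventually (\<lambda>(x', y). x' = x \<longrightarrow> y \<in> \<Union>\<K>) \<Phi>"
    proof
      fix x assume "x \<in> \<Union>\<K>"
      then obtain K where "K \<in> \<K>" "x \<in> K" by blast
      with K have "eventually (\<lambda>(x', y). x' = x \<longrightarrow> y \<in> K) \<Phi>" by blast
      then show "eventually (\<lambda>(x', y). x' = x \<longrightarrow> y \<in> \<Union>\<K>) \<Phi>"
        by eventually_elim (use \<open>K \<in> \<K>\<close> in auto)
    qed
  qed auto
  then show ?thesis
    by (simp add: uniform_topology_def topology_inverse')
qed

lemma topspace_uniform_topology:
  assumes "eventually (\<lambda>z. z \<in> S \<times> S) \<Phi>"
  shows "topspace (uniform_topology S \<Phi>) = S"
proof -
  have "openin (uniform_topology S \<Phi>) S"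
    unfolding openin_uniform_topology using assms by (auto elim: eventually_mono)
  moreover have "topspace (uniform_topology S \<Phi>) \<subseteq> S"
    using openin_topspace[of "uniform_topology S \<Phi>"] unfolding openin_uniform_topology by blast
  ultimately show ?thesis
    by (meson openin_subset subset_antisym)
qed

section \<open>The spaces \<open>X~\<close> and \<open>\<delta>\<^sub>1(X)\<close>\<close>

definition Xtilde :: "'a::uniform_space \<Rightarrow> (('a \<times> 'a) set \<Rightarrow> 'a list set) set" where
  "Xtilde p = inverse_limit (chain_space p)"

definition Xtilde_base :: "'a::uniform_space \<Rightarrow> ('a \<times> 'a) set \<Rightarrow> 'a list set" where
  "Xtilde_base p = (\<lambda>E\<in>entourages. chain_class E [p])"

definition Xtilde_uniformity ::
    "'a::uniform_space \<Rightarrow>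
      ((('a \<times> 'a) set \<Rightarrow> 'a list set) \<times> (('a \<times> 'a) set \<Rightarrow> 'a list set)) filter" where
  "Xtilde_uniformity p =
     inf (INF E \<in> entourages. filtercomap (\<lambda>(u, v). (u E, v E)) (chain_space_uniformity p E))
       (principal (Xtilde p \<times> Xtilde p))"

definition Xtilde_top :: "'a::uniform_space \<Rightarrow> (('a \<times> 'a) set \<Rightarrow> 'a list set) topology" where
  "Xtilde_top p = uniform_topology (Xtilde p) (Xtilde_uniformity p)"

lemma topspace_Xtilde_top: "topspace (Xtilde_top p) = Xtilde p"
  unfolding Xtilde_top_def
  by (rule topspace_uniform_topology)
    (simp add: Xtilde_uniformity_def eventually_inf_principal)

text \<open>
  The identification of \<open>X\<^sub>E\<close> for \<open>E = X \<times> X\<close> with \<open>X\<close> sends a class of chains to the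
  common endpoint of its members.
\<close>

definition class_end :: "'a list set \<Rightarrow> 'a" where
  "class_end C = (THE x. \<forall>\<alpha>\<in>C. last \<alpha> = x)"

definition Xtilde_proj :: "(('a \<times> 'a) set \<Rightarrow> 'a list set) \<Rightarrow> 'a" where
  "Xtilde_proj u = class_end (u UNIV)"

definition delta1 :: "'a::uniform_space \<Rightarrow> (('a \<times> 'a) set \<Rightarrow> 'a list set) set" where
  "delta1 p = inverse_limit (loop_classes p)"

definition delta1_top :: "'a::uniform_space \<Rightarrow> (('a \<times> 'a) set \<Rightarrow> 'a list set) topology" where
  "delta1_top p =
     subtopology (product_topology (\<lambda>E. discrete_topology (loop_classes p E)) entourages) (delta1 p)"

lemma topspace_delta1_top: "topspace (delta1_top p) = delta1 p"
  by (auto simp: delta1_top_def delta1_def inverse_limit_def)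

section \<open>Lifts of paths and the homomorphism \<open>\<lambda>\<close>\<close>

definition lift_path :: "'a::uniform_space \<Rightarrow> (real \<Rightarrow> 'a) \<Rightarrow> real \<Rightarrow> ('a \<times> 'a) set \<Rightarrow> 'a list set" where
  "lift_path p c = (THE cL. cL \<in> extensional {0..1} \<and> pathin (Xtilde_top p) cL \<and>
     cL 0 = Xtilde_base p \<and> (\<forall>t\<in>{0..1}. Xtilde_proj (cL t) = c t))"

definition fundamental_group :: "'a::topological_space \<Rightarrow> (real \<Rightarrow> 'a) set set" where
  "fundamental_group p =
     {c. path c \<and> pathstart c = p \<and> pathfinish c = p} // {(c, d). homotopic_paths UNIV c d}"

definition lambda_hom ::
    "'a::uniform_space \<Rightarrow> (real \<Rightarrow> 'a) set \<Rightarrow> ('a \<times> 'a) set \<Rightarrow> 'a list set" where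
  "lambda_hom p C = (THE u. \<forall>c\<in>C. lift_path p c 1 = u)"

end

theory Submission
  imports Defs
begin

text \<open>
  A point \<open>u\<close> of \<open>Xtilde p\<close> is a compatible family of chain classes. Every neighbourhood of \<open>u\<close>
  contains all points that agree with \<open>u\<close> in the coordinate at some sufficiently small entourage \<open>F\<close>
  (\<open>Xtilde_uniformity_coordinate\<close>), because a neighbourhood involves finitely many coordinates and the
  coordinate at \<open>F\<close> determines those at all larger entourages. By hypothesis \<open>F\<close> may be chosen with
  path connected balls. Represent the coordinate of \<open>u\<close> at \<open>F\<close> by an \<open>F\<close>-chain \<open>\<alpha>\<close> and join its
  consecutive points by paths inside \<open>F\<close>-balls. The lift of the resulting path has at \<open>F\<close> the
  coordinate represented by \<open>\<alpha>\<close> (\<open>path_lifting_to_chain\<close>), hence it leads from the basepoint into the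
  given neighbourhood. If \<open>u\<close> lies in \<open>delta1 p\<close>, then \<open>\<alpha>\<close> is a loop, so is the path, and the end of
  the lift is the value of \<open>lambda_hom\<close> on its homotopy class; this gives the second density claim.

  The remaining work is to show that lifts of paths exist, are unique, and have an endpoint that
  depends only on the homotopy class of the path (\<open>lift_path\<close>, \<open>lift_path_homotopic\<close>). The basic
  observation is that a class near \<open>[\<alpha>]\<close> whose members end at \<open>y\<close> must be \<open>[\<alpha>, y]\<close>. So, over one
  entourage, a continuous lift is the same as a family of chains \<open>a t\<close> ending at \<open>c t\<close> with \<open>a s\<close>
  homotopic to \<open>a t\<close> extended by \<open>c s\<close> whenever \<open>s\<close> is near \<open>t\<close>. This notion, \<open>chain_lift\<close>, is local,
  and uniqueness and homotopy invariance follow from the fact that locally constant functions on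
  intervals are constant.
\<close>

section \<open>Entourages\<close>

lemma entourage_refl: "E \<in> entourages \<Longrightarrow> (x, x) \<in> E"
  using uniformity_refl[of "\<lambda>z. z \<in> E"] by (auto simp: entourages_def)

lemma entourage_sym: "E \<in> entourages \<Longrightarrow> (x, y) \<in> E \<Longrightarrow> (y, x) \<in> E"
  by (auto simp: entourages_def dest: symD)

lemma UNIV_entourage: "UNIV \<in> entourages"
  by (auto simp: entourages_def sym_def)

lemma Inter_entourages:
  assumes "finite \<E>" "\<E> \<subseteq> entourages"
  shows "\<Inter>\<E> \<in> entourages"
proof -
  have "\<forall>\<^sub>F z in uniformity. \<forall>E\<in>\<E>. z \<in> E"
    by (rule eventually_ball_finite[OF assms(1)]) (use assms(2) in \<open>auto simp: entourages_def\<close>)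
  moreover have "sym (\<Inter>\<E>)"
    using assms(2) unfolding entourages_def sym_def by blast
  ultimately show ?thesis
    by (simp add: entourages_def)
qed

lemma entourage_half:
  fixes E :: "('a::uniform_space \<times> 'a) set"
  assumes "E \<in> entourages"
  obtains D where "D \<in> entourages" "\<And>x y z. (x, y) \<in> D \<Longrightarrow> (y, z) \<in> D \<Longrightarrow> (x, z) \<in> E"
proof -
  have "eventually (\<lambda>z. z \<in> E) uniformity"
    using assms by (simp add: entourages_def)
  then obtain P where P: "eventually P uniformity"
      "\<And>x y z. P (x, y) \<Longrightarrow> P (y, z) \<Longrightarrow> (x, z) \<in> E"
    using uniformity_trans[of "\<lambda>z. z \<in> E"] by blast
  define D where "D = {(x, y). P (x, y) \<and> P (y, x)}"
  have "eventually (\<lambda>z. z \<in> D) uniformity"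
    using eventually_conj[OF P(1) uniformity_sym[OF P(1)]]
    by (rule eventually_mono) (auto simp: D_def)
  moreover have "sym D"
    by (auto simp: D_def sym_def)
  ultimately have "D \<in> entourages"
    by (simp add: entourages_def)
  with P(2) show ?thesis
    by (intro that[of D]) (auto simp: D_def)
qed

lemma eventually_nhds_entourage:
  "E \<in> entourages \<Longrightarrow> \<forall>\<^sub>F y in nhds x. (x, y) \<in> E"
  unfolding eventually_nhds_uniformity entourages_def
  by (auto elim: eventually_mono)

text \<open>
  Neighbourhoods in a uniform space come from arbitrary members of the uniformity, whereas
  entourages are symmetric. Symmetrizing is harmless because only pairs with first component \<open>x\<close>
  matter.
\<close>

lemma nhds_entourageE:
  fixes x :: "'a::uniform_space"
  assumes "eventually P (nhds x)"
  obtains D where "D \<in> entourages" "\<And>y. (x, y) \<in> D \<Longrightarrow> P y"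
proof -
  define R where "R = {(x', y). (x' = x \<longrightarrow> P y) \<and> (y = x \<longrightarrow> P x')}"
  have *: "\<forall>\<^sub>F z in uniformity. case z of (x', y) \<Rightarrow> x' = x \<longrightarrow> P y"
    using assms by (simp add: eventually_nhds_uniformity)
  have "eventually (\<lambda>z. z \<in> R) uniformity"
    using eventually_conj[OF * uniformity_sym[OF *]]
    by (rule eventually_mono) (auto simp: R_def)
  moreover have "sym R"
    by (auto simp: R_def sym_def)
  ultimately show ?thesis
    by (intro that[of R]) (auto simp: entourages_def R_def)
qed

text \<open>
  The usual proof with a Lebesgue number: cover the compact set by open sets whose images are
  \<open>E\<close>-small, which exist because \<open>D \<circ> D \<subseteq> E\<close> for some entourage \<open>D\<close>.
\<close>

lemma compact_uniformly_continuous_entourage: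
  fixes f :: "'b::metric_space \<Rightarrow> 'a::uniform_space"
  assumes "compact K" "continuous_on K f" "E \<in> entourages"
  obtains \<delta> where "\<delta> > 0" "\<And>x y. x \<in> K \<Longrightarrow> y \<in> K \<Longrightarrow> dist x y < \<delta> \<Longrightarrow> (f x, f y) \<in> E"
proof -
  obtain D where D: "D \<in> entourages" "\<And>x y z. (x, y) \<in> D \<Longrightarrow> (y, z) \<in> D \<Longrightarrow> (x, z) \<in> E"
    using entourage_half[OF assms(3)] by blast
  define \<G> where "\<G> = {G. open G \<and> (\<forall>x\<in>G \<inter> K. \<forall>y\<in>G \<inter> K. (f x, f y) \<in> E)}"
  have "\<exists>G\<in>\<G>. x \<in> G" if x: "x \<in> K" for x
  proof -
    obtain U where U: "open U" "f x \<in> U" "\<And>y. y \<in> U \<Longrightarrow> (f x, y) \<in> D"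
      using eventually_nhds_entourage[OF D(1), of "f x"] by (auto simp: eventually_nhds)
    obtain V where V: "open V" "V \<inter> K = f -` U \<inter> K"
      using assms(2) U(1) unfolding continuous_on_open_invariant by blast
    have "V \<in> \<G>"
      unfolding \<G>_def
    proof (intro CollectI conjI ballI V(1))
      fix y z assume "y \<in> V \<inter> K" "z \<in> V \<inter> K"
      then have "(f x, f y) \<in> D" "(f x, f z) \<in> D"
        using U(3) V(2) by auto
      then show "(f y, f z) \<in> E"
        using D(2) entourage_sym[OF D(1)] by blast
    qed
    moreover have "x \<in> V"
      using V(2) U(2) x by blast
    ultimately show ?thesis by blast
  qed
  then have "K \<subseteq> \<Union>\<G>" by blast
  moreover have "open G" if "G \<in> \<G>" for G
    using that by (simp add: \<G>_def)
  ultimately obtain \<delta> where \<delta>: "0 < \<delta>" "\<And>x. x \<in> K \<Longrightarrow> \<exists>G\<in>\<G>. ball x \<delta> \<subseteq> G"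
    using Heine_Borel_lemma[OF assms(1), of \<G>] by metis
  show ?thesis
  proof (rule that[OF \<delta>(1)])
    fix x y assume xy: "x \<in> K" "y \<in> K" "dist x y < \<delta>"
    then obtain G where "G \<in> \<G>" "ball x \<delta> \<subseteq> G"
      using \<delta>(2) by blast
    moreover have "x \<in> ball x \<delta>" "y \<in> ball x \<delta>"
      using xy \<delta>(1) by auto
    ultimately have "x \<in> G" "y \<in> G" by auto
    then show "(f x, f y) \<in> E"
      using xy \<open>G \<in> \<G>\<close> by (auto simp: \<G>_def)
  qed
qed

section \<open>Homotopy of chains\<close>

lemma chain_snoc: "chain E (\<alpha> @ [y]) \<longleftrightarrow> \<alpha> = [] \<or> chain E \<alpha> \<and> (last \<alpha>, y) \<in> E"
  by (auto simp: chain_def successively_append_iff)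

lemma chain_mono: "F \<subseteq> E \<Longrightarrow> chain F \<alpha> \<Longrightarrow> chain E \<alpha>"
  unfolding chain_def by (auto intro: successively_mono)

lemma chain_homotopy_chain:
  assumes "(\<alpha>, \<beta>) \<in> chain_homotopy E"
  shows "chain E \<alpha>" "chain E \<beta>"
  using assms by (auto simp: chain_homotopy_def)

lemma chain_homotopy_refl: "chain E \<alpha> \<Longrightarrow> (\<alpha>, \<alpha>) \<in> chain_homotopy E"
  by (simp add: chain_homotopy_def)

lemma chain_homotopy_trans [trans]:
  "(\<alpha>, \<beta>) \<in> chain_homotopy E \<Longrightarrow> (\<beta>, \<gamma>) \<in> chain_homotopy E \<Longrightarrow> (\<alpha>, \<gamma>) \<in> chain_homotopy E"
  by (auto simp: chain_homotopy_def)

lemma chain_homotopy_sym: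
  assumes "(\<alpha>, \<beta>) \<in> chain_homotopy E"
  shows "(\<beta>, \<alpha>) \<in> chain_homotopy E"
proof -
  have "symp (\<lambda>\<gamma> \<delta>. add_point E \<gamma> \<delta> \<or> add_point E \<delta> \<gamma>)"
    by (auto simp: symp_def)
  then show ?thesis
    using assms sympD[OF symp_rtranclp, of "\<lambda>\<gamma> \<delta>. add_point E \<gamma> \<delta> \<or> add_point E \<delta> \<gamma>"]
    by (simp add: chain_homotopy_def)
qed

lemma add_point_imp_chain_homotopy: "add_point E \<alpha> \<beta> \<Longrightarrow> (\<alpha>, \<beta>) \<in> chain_homotopy E"
  unfolding chain_homotopy_def using add_point_def[of E \<alpha> \<beta>] by blast

lemma chain_homotopy_hd_last:
  assumes "(\<alpha>, \<beta>) \<in> chain_homotopy E"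
  shows "hd \<beta> = hd \<alpha>" "last \<beta> = last \<alpha>"
proof -
  have "(\<lambda>\<gamma> \<delta>. add_point E \<gamma> \<delta> \<or> add_point E \<delta> \<gamma>)\<^sup>*\<^sup>* \<alpha> \<beta>"
    using assms by (simp add: chain_homotopy_def)
  then have "hd \<beta> = hd \<alpha> \<and> last \<beta> = last \<alpha>"
    by induction (auto simp: add_point_def)
  then show "hd \<beta> = hd \<alpha>" "last \<beta> = last \<alpha>" by auto
qed

lemma chain_homotopy_mono:
  assumes "F \<subseteq> E"
  shows "chain_homotopy F \<subseteq> chain_homotopy E"
proof -
  have "add_point F \<gamma> \<delta> \<Longrightarrow> add_point E \<gamma> \<delta>" for \<gamma> \<delta>
    using chain_mono[OF assms] unfolding add_point_def by blast
  then have "(\<lambda>\<gamma> \<delta>. add_point F \<gamma> \<delta> \<or> add_point F \<delta> \<gamma>)\<^sup>*\<^sup>* \<le>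
      (\<lambda>\<gamma> \<delta>. add_point E \<gamma> \<delta> \<or> add_point E \<delta> \<gamma>)\<^sup>*\<^sup>*"
    by (intro rtranclp_mono) auto
  then show ?thesis
    using chain_mono[OF assms] unfolding chain_homotopy_def le_fun_def le_bool_def by blast
qed

lemma add_pointI:
  assumes "chain E (xs @ ys)" "chain E (xs @ x # ys)"
    "hd (xs @ x # ys) = hd (xs @ ys)" "last (xs @ x # ys) = last (xs @ ys)"
  shows "add_point E (xs @ ys) (xs @ x # ys)"
  unfolding add_point_def
proof (intro conjI)
  show "\<exists>us u vs. xs @ ys = us @ vs \<and> xs @ x # ys = us @ [u] @ vs"
    by (rule exI[of _ xs], rule exI[of _ x], rule exI[of _ ys]) simp
qed (fact assms)+

lemma add_point_snoc:
  assumes "add_point E \<alpha> \<beta>" "(last \<alpha>, y) \<in> E"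
  shows "add_point E (\<alpha> @ [y]) (\<beta> @ [y])"
proof -
  obtain xs x ys where eq: "\<alpha> = xs @ ys" "\<beta> = xs @ [x] @ ys"
    using assms unfolding add_point_def by blast
  have ch: "chain E \<alpha>" "chain E \<beta>" "hd \<beta> = hd \<alpha>" "last \<beta> = last \<alpha>"
    using assms unfolding add_point_def by blast+
  then have "\<alpha> \<noteq> []" "\<beta> \<noteq> []"
    by (simp_all add: chain_def)
  with ch assms(2) have "hd (\<beta> @ [y]) = hd (\<alpha> @ [y])" "chain E (\<alpha> @ [y])" "chain E (\<beta> @ [y])"
    by (simp_all add: chain_snoc)
  then show ?thesis
    using add_pointI[of E xs "ys @ [y]" x] by (simp add: eq)
qed

text \<open>
  Appending a point is well defined on homotopy classes; a class extended by one point is the only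
  way in which classes are changed in what follows.
\<close>

lemma chain_homotopy_snoc:
  assumes "(\<alpha>, \<beta>) \<in> chain_homotopy E" "(last \<alpha>, y) \<in> E"
  shows "(\<alpha> @ [y], \<beta> @ [y]) \<in> chain_homotopy E"
proof -
  have "(\<lambda>\<gamma> \<delta>. add_point E \<gamma> \<delta> \<or> add_point E \<delta> \<gamma>)\<^sup>*\<^sup>* \<alpha> \<beta>" "chain E \<alpha>"
    using assms(1) by (simp_all add: chain_homotopy_def)
  then have "last \<beta> = last \<alpha> \<and> (\<alpha> @ [y], \<beta> @ [y]) \<in> chain_homotopy E"
  proof induction
    case base
    then show ?case
      using assms(2) by (simp add: chain_homotopy_refl chain_snoc)
  next
    case (step \<beta> \<gamma>)
    from step.IH step.prems have IH: "last \<beta> = last \<alpha>" "(\<alpha> @ [y], \<beta> @ [y]) \<in> chain_homotopy E"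
      by auto
    have last: "last \<gamma> = last \<beta>"
      using step.hyps(2) by (auto simp: add_point_def)
    have "(\<beta> @ [y], \<gamma> @ [y]) \<in> chain_homotopy E"
      using step.hyps(2)
    proof
      assume "add_point E \<beta> \<gamma>"
      then show ?thesis
        using IH(1) assms(2) by (simp add: add_point_snoc add_point_imp_chain_homotopy)
    next
      assume "add_point E \<gamma> \<beta>"
      then show ?thesis
        using IH(1) assms(2) last
        by (simp add: add_point_snoc add_point_imp_chain_homotopy chain_homotopy_sym)
    qed
    with IH last show ?case
      by (auto intro: chain_homotopy_trans)
  qed
  then show ?thesis ..
qed

text \<open>
  Together with the next lemma, this move is the only homotopy ever performed by hand: all other
  homotopies are obtained from it by composition and by appending points.
\<close>

lemma chain_homotopy_remove_penultimate:
  assumes "chain E (\<alpha> @ [x, y])" "\<alpha> \<noteq> []" "(last \<alpha>, y) \<in> E"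
  shows "(\<alpha> @ [x, y], \<alpha> @ [y]) \<in> chain_homotopy E"
proof -
  have "chain E (\<alpha> @ [y])"
    using assms chain_snoc[of E "\<alpha> @ [x]" y] by (simp add: chain_snoc)
  then have "add_point E (\<alpha> @ [y]) (\<alpha> @ [x, y])"
    using assms by (intro add_pointI) simp_all
  then show ?thesis
    by (rule chain_homotopy_sym[OF add_point_imp_chain_homotopy])
qed

lemma chain_homotopy_repeat_last:
  assumes "E \<in> entourages" "chain E \<alpha>"
  shows "(\<alpha> @ [last \<alpha>], \<alpha>) \<in> chain_homotopy E"
proof -
  have "\<alpha> \<noteq> []"
    using assms by (simp add: chain_def)
  then have "add_point E (\<alpha> @ []) (\<alpha> @ [last \<alpha>])"
    using assms entourage_refl[OF assms(1)] by (intro add_pointI) (simp_all add: chain_snoc)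
  then show ?thesis
    using chain_homotopy_sym[OF add_point_imp_chain_homotopy] by simp
qed

lemma chain_class_eq_iff:
  assumes "chain E \<alpha>"
  shows "chain_class E \<alpha> = chain_class E \<beta> \<longleftrightarrow> (\<alpha>, \<beta>) \<in> chain_homotopy E"
proof
  assume "chain_class E \<alpha> = chain_class E \<beta>"
  then have "(\<beta>, \<alpha>) \<in> chain_homotopy E"
    using chain_homotopy_refl[OF assms] by blast
  then show "(\<alpha>, \<beta>) \<in> chain_homotopy E"
    by (rule chain_homotopy_sym)
next
  assume h: "(\<alpha>, \<beta>) \<in> chain_homotopy E"
  show "chain_class E \<alpha> = chain_class E \<beta>"
    by (auto intro: chain_homotopy_trans[OF h] chain_homotopy_trans[OF chain_homotopy_sym[OF h]])
qed

lemma chain_class_eqI: "(\<alpha>, \<beta>) \<in> chain_homotopy E \<Longrightarrow> chain_class E \<alpha> = chain_class E \<beta>"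
  using chain_class_eq_iff chain_homotopy_chain(1) by metis

lemma bond_chain_class:
  assumes "F \<subseteq> E" "chain F \<alpha>"
  shows "bond E (chain_class F \<alpha>) = chain_class E \<alpha>"
proof
  show "bond E (chain_class F \<alpha>) \<subseteq> chain_class E \<alpha>"
  proof
    fix \<gamma> assume "\<gamma> \<in> bond E (chain_class F \<alpha>)"
    then obtain \<beta> where "(\<alpha>, \<beta>) \<in> chain_homotopy E" "(\<beta>, \<gamma>) \<in> chain_homotopy E"
      using chain_homotopy_mono[OF assms(1)] unfolding bond_def by blast
    then show "\<gamma> \<in> chain_class E \<alpha>"
      using chain_homotopy_trans by blast
  qed
  show "chain_class E \<alpha> \<subseteq> bond E (chain_class F \<alpha>)"
    using chain_homotopy_refl[OF assms(2)] unfolding bond_def by blast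
qed

lemma class_end_chain_class:
  assumes "chain E \<alpha>"
  shows "class_end (chain_class E \<alpha>) = last \<alpha>"
  unfolding class_end_def
proof (rule the_equality)
  show "\<forall>\<beta>\<in>chain_class E \<alpha>. last \<beta> = last \<alpha>"
    using chain_homotopy_hd_last(2) by auto
next
  fix x assume "\<forall>\<beta>\<in>chain_class E \<alpha>. last \<beta> = x"
  then show "x = last \<alpha>"
    using chain_homotopy_refl[OF assms] by auto
qed

section \<open>Chain lifts of maps\<close>

text \<open>
  A chain lift is a choice of representatives for a lift of \<open>c\<close> to the space of \<open>E\<close>-chain classes.
  Two classes over nearby points are close exactly when one is the other extended by its new endpoint,
  so the third condition expresses continuity without mentioning the uniformity on classes. Working
  with representatives makes a chain lift for \<open>F \<subseteq> E\<close> literally a chain lift for \<open>E\<close>, so that the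
  bonding maps disappear.
\<close>

definition chain_lift ::
    "('a::uniform_space \<times> 'a) set \<Rightarrow> 'b::topological_space set \<Rightarrow> ('b \<Rightarrow> 'a) \<Rightarrow> ('b \<Rightarrow> 'a list) \<Rightarrow> bool"
  where
  "chain_lift E S c a \<longleftrightarrow>
     (\<forall>t\<in>S. chain E (a t) \<and> last (a t) = c t \<and>
        (\<forall>\<^sub>F s in nhds t. s \<in> S \<longrightarrow> (c t, c s) \<in> E \<and> (a t @ [c s], a s) \<in> chain_homotopy E))"

lemma chain_liftD:
  assumes "chain_lift E S c a" "t \<in> S"
  shows "chain E (a t)" "last (a t) = c t"
    "\<forall>\<^sub>F s in nhds t. s \<in> S \<longrightarrow> (c t, c s) \<in> E \<and> (a t @ [c s], a s) \<in> chain_homotopy E"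
  using assms by (auto simp: chain_lift_def)

text \<open>
  Moving to a nearby point \<open>y\<close> and back again changes nothing, so the relation "\<open>\<beta>\<close> is \<open>\<alpha>\<close> extended
  by one point" between classes is symmetric.
\<close>

lemma chain_homotopy_snoc_back:
  assumes "E \<in> entourages" "chain E \<alpha>" "(last \<alpha>, y) \<in> E" "(\<alpha> @ [y], \<beta>) \<in> chain_homotopy E"
  shows "(\<beta> @ [last \<alpha>], \<alpha>) \<in> chain_homotopy E"
proof -
  have ne: "\<alpha> \<noteq> []"
    using assms by (simp add: chain_def)
  have yx: "(y, last \<alpha>) \<in> E"
    using assms entourage_sym by blast
  have "(\<beta> @ [last \<alpha>], (\<alpha> @ [y]) @ [last \<alpha>]) \<in> chain_homotopy E"
    by (rule chain_homotopy_snoc) (use chain_homotopy_hd_last(2)[OF assms(4)] yx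
        chain_homotopy_sym[OF assms(4)] in auto)
  also have "((\<alpha> @ [y]) @ [last \<alpha>], \<alpha> @ [last \<alpha>]) \<in> chain_homotopy E"
    using chain_homotopy_remove_penultimate[of E \<alpha> y "last \<alpha>"] ne assms yx entourage_refl[OF assms(1)]
    using chain_snoc[of E "\<alpha> @ [y]" "last \<alpha>"] by (simp add: chain_snoc)
  also have "(\<alpha> @ [last \<alpha>], \<alpha>) \<in> chain_homotopy E"
    by (rule chain_homotopy_repeat_last[OF assms(1,2)])
  finally show ?thesis .
qed

text \<open>
  The class at \<open>s\<close> near \<open>t\<close> is determined by the class at \<open>t\<close> and by \<open>c s\<close>, and conversely. Hence
  agreement of two chain lifts is locally constant.
\<close>

lemma chain_lift_unique:
  assumes "E \<in> entourages" "connected S" "chain_lift E S c a" "chain_lift E S c b"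
    and "t\<^sub>0 \<in> S" "(a t\<^sub>0, b t\<^sub>0) \<in> chain_homotopy E" "t \<in> S"
  shows "(a t, b t) \<in> chain_homotopy E"
proof -
  let ?f = "\<lambda>t. (a t, b t) \<in> chain_homotopy E"
  have "\<forall>t\<in>S. \<forall>\<^sub>F s in at t within S. ?f t = ?f s"
  proof
    fix t assume t: "t \<in> S"
    have "\<forall>\<^sub>F s in nhds t. s \<in> S \<longrightarrow> ?f t = ?f s"
      using chain_liftD(3)[OF assms(3) t] chain_liftD(3)[OF assms(4) t]
    proof eventually_elim
      case (elim s)
      show ?case
      proof
        assume s: "s \<in> S"
        with elim have A: "(c t, c s) \<in> E" "(a t @ [c s], a s) \<in> chain_homotopy E"
            "(b t @ [c s], b s) \<in> chain_homotopy E" by auto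
        note l = chain_liftD(1,2)[OF assms(3) t] chain_liftD(1,2)[OF assms(4) t]
        have B: "(a s @ [c t], a t) \<in> chain_homotopy E" "(b s @ [c t], b t) \<in> chain_homotopy E"
          using chain_homotopy_snoc_back[OF assms(1) l(1) _ A(2)]
            chain_homotopy_snoc_back[OF assms(1) l(3) _ A(3)] l A(1) by auto
        have "(c s, c t) \<in> E"
          using A(1) assms(1) entourage_sym by blast
        show "?f t = ?f s"
        proof
          assume "?f t"
          from chain_homotopy_snoc[OF this, of "c s"] l A show "?f s"
            using chain_homotopy_sym chain_homotopy_trans by metis
        next
          assume "?f s"
          from chain_homotopy_snoc[OF this, of "c t"] B \<open>(c s, c t) \<in> E\<close>
            chain_liftD(2)[OF assms(3) s] show "?f t"
            using chain_homotopy_sym chain_homotopy_trans by metis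
        qed
      qed
    qed
    then show "\<forall>\<^sub>F s in at t within S. ?f t = ?f s"
      unfolding eventually_at_filter by eventually_elim auto
  qed
  from connected_local_const[OF assms(2) assms(5) assms(7) this] assms(6) show ?thesis
    by blast
qed

lemma chain_lift_compose:
  assumes "chain_lift E S c a" "continuous_on T f" "f ` T \<subseteq> S"
  shows "chain_lift E T (c \<circ> f) (a \<circ> f)"
  unfolding chain_lift_def
proof (intro ballI conjI)
  fix t assume t: "t \<in> T"
  then have ft: "f t \<in> S"
    using assms(3) by blast
  show "chain E ((a \<circ> f) t)" "last ((a \<circ> f) t) = (c \<circ> f) t"
    using chain_liftD[OF assms(1) ft] by auto
  let ?P = "\<lambda>x. x \<in> S \<longrightarrow> (c (f t), c x) \<in> E \<and> (a (f t) @ [c x], a x) \<in> chain_homotopy E"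
  have P: "eventually ?P (nhds (f t))"
    by (rule chain_liftD(3)[OF assms(1) ft])
  have "(f \<longlongrightarrow> f t) (at t within T)"
    using assms(2) t by (simp add: continuous_on)
  from eventually_compose_filterlim[OF P this]
  have "\<forall>\<^sub>F s in nhds t. s \<noteq> t \<longrightarrow> s \<in> T \<longrightarrow> ?P (f s)"
    by (simp add: eventually_at_filter)
  then show "\<forall>\<^sub>F s in nhds t. s \<in> T \<longrightarrow> ((c \<circ> f) t, (c \<circ> f) s) \<in> E \<and>
      ((a \<circ> f) t @ [(c \<circ> f) s], (a \<circ> f) s) \<in> chain_homotopy E"
    by eventually_elim (use eventually_nhds_x_imp_x[OF P] assms(3) in fastforce)
qed

lemma chain_lift_mono:
  assumes "chain_lift F S c a" "F \<subseteq> E"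
  shows "chain_lift E S c a"
  unfolding chain_lift_def
proof (intro ballI conjI)
  fix t assume t: "t \<in> S"
  show "chain E (a t)" "last (a t) = c t"
    using chain_liftD[OF assms(1) t] chain_mono[OF assms(2)] by auto
  show "\<forall>\<^sub>F s in nhds t. s \<in> S \<longrightarrow> (c t, c s) \<in> E \<and> (a t @ [c s], a s) \<in> chain_homotopy E"
    using chain_liftD(3)[OF assms(1) t]
    by (rule eventually_mono) (use chain_homotopy_mono[OF assms(2)] assms(2) in blast)
qed

lemma chain_lift_cong:
  assumes "chain_lift E S c a" "\<And>t. t \<in> S \<Longrightarrow> c' t = c t" "\<And>t. t \<in> S \<Longrightarrow> a' t = a t"
  shows "chain_lift E S c' a'"
  unfolding chain_lift_def
proof (intro ballI conjI)
  fix t assume t: "t \<in> S"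
  show "chain E (a' t)" "last (a' t) = c' t"
    using chain_liftD[OF assms(1) t] assms(2,3)[OF t] by auto
  show "\<forall>\<^sub>F s in nhds t. s \<in> S \<longrightarrow> (c' t, c' s) \<in> E \<and> (a' t @ [c' s], a' s) \<in> chain_homotopy E"
    using chain_liftD(3)[OF assms(1) t] by (rule eventually_mono) (use assms(2,3) t in simp)
qed

section \<open>Existence of chain lifts of paths\<close>

text \<open>
  The lift of a path that stays, during the \<open>k\<close>-th unit of time, in the \<open>E\<close>-ball around its value
  at the beginning of that unit: record the values at the integers passed so far and append the
  current one. Asking only for closeness to the beginning of the unit lets the same lemma apply both to
  fine subdivisions of an arbitrary path and to paths built to follow a given chain.
\<close>

lemma chain_lift_grid:
  fixes c :: "real \<Rightarrow> 'a::uniform_space"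
  assumes E: "E \<in> entourages" and cont: "continuous_on {0..real n} c"
    and near: "\<And>k t. k < n \<Longrightarrow> t \<in> {real k..real k + 1} \<Longrightarrow> (c (real k), c t) \<in> E"
  shows "chain_lift E {0..real n} c (\<lambda>t. map (\<lambda>i. c (real i)) [0..<Suc (nat \<lfloor>t\<rfloor>)] @ [c t])"
proof -
  define g where "g k = map (\<lambda>i. c (real i)) [0..<Suc k]" for k :: nat
  define a where "a t = g (nat \<lfloor>t\<rfloor>) @ [c t]" for t
  have g_Suc: "g (Suc k) = g k @ [c (real (Suc k))]" for k
    by (simp add: g_def)
  have g_ne: "g k \<noteq> []" and last_g: "last (g k) = c (real k)" for k
    by (simp_all add: g_def)
  have chain_g: "chain E (g k)" if "k \<le> n" for k
    using that
  proof (induction k)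
    case 0
    then show ?case by (simp add: g_def chain_def)
  next
    case (Suc k)
    then have "(c (real k), c (real (Suc k))) \<in> E"
      by (intro near) auto
    with Suc show ?case
      by (simp add: g_Suc chain_snoc last_g)
  qed
  have near': "(c (real k), c t) \<in> E" if "real k \<le> t" "t < real k + 1" "t \<in> {0..real n}" for k t
  proof (cases "k < n")
    case True
    then show ?thesis using that by (intro near) auto
  next
    case False
    then have "t = real k" using that by auto
    then show ?thesis using entourage_refl[OF E] by simp
  qed
  have chain_a: "chain E (a t)" if "t \<in> {0..real n}" for t
  proof -
    define k where "k = nat \<lfloor>t\<rfloor>"
    have "k \<le> n" "real k \<le> t" "t < real k + 1"
      using that by (auto simp: k_def le_nat_floor floor_le_iff nat_le_iff)
    then show ?thesis
      using chain_g near'[of k t] that by (simp add: a_def chain_snoc last_g flip: k_def)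
  qed
  have "chain_lift E {0..real n} c a"
    unfolding chain_lift_def
  proof (intro ballI conjI)
    fix t assume t: "t \<in> {0..real n}"
    show "chain E (a t)" by (rule chain_a[OF t])
    show "last (a t) = c t" by (simp add: a_def)
    define k where "k = nat \<lfloor>t\<rfloor>"
    have k: "k \<le> n" "real k \<le> t" "t < real k + 1"
      using t by (auto simp: k_def le_nat_floor floor_le_iff nat_le_iff)
    \<comment> \<open>Near an integer time the previous unit interval has to be considered as well.\<close>
    define l where "l = (if t = real k then real k - 1 else real k)"
    have "(c \<longlongrightarrow> c t) (at t within {0..real n})"
      using cont t by (simp add: continuous_on)
    from eventually_compose_filterlim[OF eventually_nhds_entourage[OF E] this]
    have "\<forall>\<^sub>F s in nhds t. s \<noteq> t \<longrightarrow> s \<in> {0..real n} \<longrightarrow> (c t, c s) \<in> E"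
      by (simp add: eventually_at_filter)
    moreover have "\<forall>\<^sub>F s in nhds t. s \<in> {l<..<real k + 1}"
      by (rule eventually_nhds_in_open) (use k in \<open>auto simp: l_def\<close>)
    ultimately show "\<forall>\<^sub>F s in nhds t. s \<in> {0..real n} \<longrightarrow>
        (c t, c s) \<in> E \<and> (a t @ [c s], a s) \<in> chain_homotopy E"
    proof eventually_elim
      case (elim s)
      show ?case
      proof
        assume s: "s \<in> {0..real n}"
        have ts: "(c t, c s) \<in> E"
          using elim s entourage_refl[OF E] by (cases "s = t") auto
        have "(a t @ [c s], a s) \<in> chain_homotopy E"
        proof (cases "real k \<le> s")
          case True
          then have "nat \<lfloor>s\<rfloor> = k"
            using elim by (auto simp: nat_eq_iff floor_eq_iff)
          then have as: "a s = g k @ [c s]" and at: "a t = g k @ [c t]"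
            by (simp_all add: a_def k_def)
          have "(last (g k), c s) \<in> E"
            using near'[of k s] True elim s by (simp add: last_g)
          moreover have "chain E (g k @ [c t, c s])"
            using chain_a[OF t] ts chain_snoc[of E "a t" "c s"] by (simp add: at)
          ultimately show ?thesis
            using chain_homotopy_remove_penultimate[of E "g k" "c t" "c s"] g_ne by (simp add: as at)
        next
          case False
          then have tk: "t = real k" and sl: "real k - 1 < s"
            using elim by (auto simp: l_def split: if_splits)
          obtain j where j: "k = Suc j"
            using False s by (cases k) auto
          have "nat \<lfloor>s\<rfloor> = j"
            using False sl s by (auto simp: nat_eq_iff floor_eq_iff j)
          then have as: "a s = g j @ [c s]"
            by (simp add: a_def)
          have at: "a t = g k @ [last (g k)]"
            by (simp add: a_def last_g tk)
          have "(last (g j), c t) \<in> E"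
            using near[of j t] k(1) tk by (auto simp: last_g j)
          moreover have "(c s, c t) \<in> E"
            using ts by (rule entourage_sym[OF E])
          then have "chain E (g j @ [c s, c t])"
            using chain_a[OF s] chain_snoc[of E "a s" "c t"] by (simp add: as)
          ultimately have "(a s @ [c t], g k) \<in> chain_homotopy E"
            using chain_homotopy_remove_penultimate[of E "g j" "c s" "c t"] g_ne
            by (simp add: as j g_Suc tk)
          also have "(g k, a t) \<in> chain_homotopy E"
            unfolding at
            by (rule chain_homotopy_sym[OF chain_homotopy_repeat_last[OF E chain_g[OF k(1)]]])
          finally have "(a s @ [c t], a t) \<in> chain_homotopy E" .
          from chain_homotopy_snoc_back[OF E chain_a[OF s] _ this] \<open>(c s, c t) \<in> E\<close>
          show ?thesis by (simp add: as)
        qed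
        with ts show "(c t, c s) \<in> E \<and> (a t @ [c s], a s) \<in> chain_homotopy E" ..
      qed
    qed
  qed
  moreover have "a = (\<lambda>t. map (\<lambda>i. c (real i)) [0..<Suc (nat \<lfloor>t\<rfloor>)] @ [c t])"
    by (simp only: a_def g_def fun_eq_iff simp_thms)
  ultimately show "chain_lift E {0..real n} c (\<lambda>t. map (\<lambda>i. c (real i)) [0..<Suc (nat \<lfloor>t\<rfloor>)] @ [c t])"
    by simp
qed

text \<open>
  Uniform continuity provides an \<open>n\<close> such that \<open>c\<close>, slowed down by the factor \<open>n\<close>, satisfies the
  hypothesis of \<open>chain_lift_grid\<close>.
\<close>

lemma chain_lift_exists:
  fixes c :: "real \<Rightarrow> 'a::uniform_space"
  assumes E: "E \<in> entourages" and cont: "continuous_on {0..1} c"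
  obtains a where "chain_lift E {0..1} c a" "(a 0, [c 0]) \<in> chain_homotopy E" "\<And>t. hd (a t) = c 0"
proof -
  obtain \<delta> where \<delta>: "\<delta> > 0"
      "\<And>x y. x \<in> {0..1} \<Longrightarrow> y \<in> {0..1} \<Longrightarrow> dist x y < \<delta> \<Longrightarrow> (c x, c y) \<in> E"
    using compact_uniformly_continuous_entourage[OF compact_Icc cont E] by metis
  obtain m where m: "1 / real (Suc m) < \<delta>"
    using nat_approx_posE[OF \<delta>(1)] by blast
  define n where "n = Suc m"
  have n: "n > 0" "1 / real n < \<delta>"
    using m by (simp_all add: n_def)
  \<comment> \<open>Time is rescaled so that the subdivision points become integers.\<close>
  define c' where "c' t = c (t / real n)" for t
  have cont': "continuous_on {0..real n} c'"
    unfolding c'_def by (rule continuous_on_compose2[OF cont]) (use n in \<open>auto intro!: continuous_intros simp: divide_simps\<close>)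
  have near: "(c' (real k), c' t) \<in> E" if "k < n" "t \<in> {real k..real k + 1}" for k t
    unfolding c'_def
  proof (rule \<delta>(2))
    have "dist (real k / real n) (t / real n) = (t - real k) / real n"
      using that n by (simp add: dist_real_def abs_if divide_simps)
    also have "\<dots> \<le> 1 / real n"
      using that by (intro divide_right_mono) auto
    finally show "dist (real k / real n) (t / real n) < \<delta>"
      using n by simp
  qed (use that n in \<open>auto simp: divide_simps\<close>)
  define b where "b t = map (\<lambda>i. c' (real i)) [0..<Suc (nat \<lfloor>t\<rfloor>)] @ [c' t]" for t
  have b: "chain_lift E {0..real n} c' b"
    unfolding b_def by (rule chain_lift_grid[OF E cont' near])
  show ?thesis
  proof (rule that[of "b \<circ> (\<lambda>t. real n * t)"])
    have "chain_lift E {0..1} (c' \<circ> (\<lambda>t. real n * t)) (b \<circ> (\<lambda>t. real n * t))"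
      by (rule chain_lift_compose[OF b]) (auto intro!: continuous_intros simp: mult_left_le)
    then show "chain_lift E {0..1} c (b \<circ> (\<lambda>t. real n * t))"
      by (rule chain_lift_cong) (use n in \<open>auto simp: c'_def\<close>)
    have "(b \<circ> (\<lambda>t. real n * t)) 0 = [c 0] @ [last [c 0]]"
      by (simp add: b_def c'_def)
    then show "((b \<circ> (\<lambda>t. real n * t)) 0, [c 0]) \<in> chain_homotopy E"
      using chain_homotopy_repeat_last[OF E, of "[c 0]"] by (simp add: chain_def)
    show "hd ((b \<circ> (\<lambda>t. real n * t)) t) = c 0" for t
      by (simp add: b_def c'_def hd_append hd_map del: upt_Suc)
  qed
qed

section \<open>Points and neighbourhoods in the inverse limit\<close>

lemma Xtilde_repr:
  assumes "u \<in> Xtilde p" "E \<in> entourages"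
  obtains \<alpha> where "chain E \<alpha>" "hd \<alpha> = p" "u E = chain_class E \<alpha>"
proof -
  have "u E \<in> chain_space p E"
    using assms by (auto simp: Xtilde_def inverse_limit_def)
  then show ?thesis
    using that by (auto simp: chain_space_def elim!: quotientE)
qed

lemma Xtilde_bond:
  assumes "u \<in> Xtilde p" "E \<in> entourages" "F \<in> entourages" "F \<subseteq> E"
  shows "bond E (u F) = u E"
  using assms by (auto simp: Xtilde_def inverse_limit_def)

lemma Xtilde_class:
  assumes "u \<in> Xtilde p" "E \<in> entourages" "\<alpha> \<in> u E"
  shows "chain E \<alpha>" "hd \<alpha> = p" "u E = chain_class E \<alpha>"
proof -
  obtain \<beta> where \<beta>: "chain E \<beta>" "hd \<beta> = p" "u E = chain_class E \<beta>"
    using Xtilde_repr[OF assms(1,2)] .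
  then have h: "(\<beta>, \<alpha>) \<in> chain_homotopy E"
    using assms(3) by simp
  show "chain E \<alpha>" "hd \<alpha> = p"
    using chain_homotopy_chain[OF h] chain_homotopy_hd_last[OF h] \<beta> by auto
  show "u E = chain_class E \<alpha>"
    using \<beta>(1,3) h chain_class_eq_iff by blast
qed

text \<open>
  The bonding maps preserve endpoints, so the endpoint of the coordinate at the largest entourage can
  be read off from any other coordinate.
\<close>

lemma Xtilde_proj_eq:
  assumes "u \<in> Xtilde p" "E \<in> entourages" "\<alpha> \<in> u E"
  shows "Xtilde_proj u = last \<alpha>"
proof -
  note \<alpha> = Xtilde_class[OF assms]
  have "u UNIV = bond UNIV (u E)"
    using Xtilde_bond[OF assms(1) UNIV_entourage assms(2)] by simp
  also have "\<dots> = chain_class UNIV \<alpha>"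
    using bond_chain_class[of E UNIV \<alpha>] \<alpha> by simp
  finally show ?thesis
    using class_end_chain_class[OF chain_mono[OF _ \<alpha>(1), of UNIV]] by (simp add: Xtilde_proj_def)
qed

text \<open>
  This lemma and its converse below show that two classes are \<open>D\<^sup>*\<close>-close if and only if the second
  is the first extended by a point that is \<open>D\<close>-close to its end.
\<close>

lemma star_entourage_snoc:
  assumes "E \<in> entourages" "D \<subseteq> E" "chain E \<alpha>" "hd \<alpha> = p" "(last \<alpha>, y) \<in> D"
  shows "(chain_class E \<alpha>, chain_class E (\<alpha> @ [y])) \<in> star_entourage p E D"
proof -
  have "\<alpha> \<noteq> []"
    using assms(3) by (simp add: chain_def)
  moreover have "chain E (\<alpha> @ [last \<alpha>])" "chain E (\<alpha> @ [y])"
    using assms entourage_refl[OF assms(1)] by (auto simp: chain_snoc)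
  moreover have "chain_class E \<alpha> = chain_class E (\<alpha> @ [last \<alpha>])"
    using chain_homotopy_sym[OF chain_homotopy_repeat_last[OF assms(1,3)]]
    by (simp add: chain_class_eq_iff[OF assms(3)])
  ultimately show ?thesis
    using assms(4,5) unfolding star_entourage_def by blast
qed

lemma star_entourageD:
  assumes "(C, C') \<in> star_entourage p E D" "D \<subseteq> E" "\<alpha> \<in> C" "\<beta> \<in> C'"
  shows "(last \<alpha>, last \<beta>) \<in> D" "(\<alpha> @ [last \<beta>], \<beta>) \<in> chain_homotopy E"
proof -
  obtain xs y z where *: "C = chain_class E (xs @ [y])" "C' = chain_class E (xs @ [z])" "xs \<noteq> []"
      "chain E (xs @ [y])" "chain E (xs @ [z])" "(y, z) \<in> D"
    using assms(1) unfolding star_entourage_def by blast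
  have \<alpha>: "(xs @ [y], \<alpha>) \<in> chain_homotopy E" and \<beta>: "(xs @ [z], \<beta>) \<in> chain_homotopy E"
    using assms(3,4) * by auto
  have last: "last \<alpha> = y" "last \<beta> = z"
    using chain_homotopy_hd_last(2)[OF \<alpha>] chain_homotopy_hd_last(2)[OF \<beta>] by simp_all
  then show "(last \<alpha>, last \<beta>) \<in> D"
    using * by simp
  have "(\<alpha> @ [z], (xs @ [y]) @ [z]) \<in> chain_homotopy E"
    by (rule chain_homotopy_snoc[OF chain_homotopy_sym[OF \<alpha>]]) (use last * assms(2) in auto)
  also have "((xs @ [y]) @ [z], xs @ [z]) \<in> chain_homotopy E"
    using chain_homotopy_remove_penultimate[of E xs y z] * assms(2) chain_snoc[of E "xs @ [y]" z]
    by (auto simp: chain_snoc[of E xs])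
  also note \<beta>
  finally show "(\<alpha> @ [last \<beta>], \<beta>) \<in> chain_homotopy E"
    by (simp add: last)
qed

lemma eventually_Xtilde_uniformity:
  assumes "E \<in> entourages" "D \<in> entourages" "D \<subseteq> E"
  shows "\<forall>\<^sub>F (u, v) in Xtilde_uniformity p. u \<in> Xtilde p \<and> v \<in> Xtilde p \<and> (u E, v E) \<in> star_entourage p E D"
proof -
  have "eventually (\<lambda>z. z \<in> star_entourage p E D) (chain_space_uniformity p E)"
    unfolding chain_space_uniformity_def
    by (rule filter_leD[OF INF_lower[of D]]) (use assms in \<open>auto simp: eventually_principal\<close>)
  then have "eventually (\<lambda>(u, v). (u E, v E) \<in> star_entourage p E D)
      (filtercomap (\<lambda>(u, v). (u E, v E)) (chain_space_uniformity p E))"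
    by (rule eventually_filtercomapI[THEN eventually_mono]) auto
  then have "eventually (\<lambda>(u, v). (u E, v E) \<in> star_entourage p E D)
      (INF E \<in> entourages. filtercomap (\<lambda>(u, v). (u E, v E)) (chain_space_uniformity p E))"
    by (rule filter_leD[OF INF_lower[OF assms(1)]])
  then show ?thesis
    unfolding Xtilde_uniformity_def eventually_inf_principal by (rule eventually_mono) auto
qed

text \<open>
  The points whose \<open>E\<close>-coordinate extends that of \<open>u\<close> by one point form a neighbourhood of \<open>u\<close>.
  An open set inside it is found by letting the new endpoint range over an open subset of the
  \<open>E\<close>-ball: a point extending an extension of \<open>\<alpha>\<close> then extends \<open>\<alpha>\<close> itself, since its end is still
  in that ball.
\<close>

lemma Xtilde_neighbourhood:
  assumes u: "u \<in> Xtilde p" and E: "E \<in> entourages" and \<alpha>: "\<alpha> \<in> u E"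
  obtains W where "openin (Xtilde_top p) W" "u \<in> W"
    "\<And>v \<beta>. v \<in> W \<Longrightarrow> \<beta> \<in> v E \<Longrightarrow> (last \<alpha>, last \<beta>) \<in> E \<and> (\<alpha> @ [last \<beta>], \<beta>) \<in> chain_homotopy E"
proof -
  have ch\<alpha>: "chain E \<alpha>"
    by (rule Xtilde_class(1)[OF u E \<alpha>])
  then have ne: "\<alpha> \<noteq> []"
    by (simp add: chain_def)
  obtain G where G: "open G" "last \<alpha> \<in> G" "\<And>y. y \<in> G \<Longrightarrow> (last \<alpha>, y) \<in> E"
    using eventually_nhds_entourage[OF E, of "last \<alpha>"] by (auto simp: eventually_nhds)
  define W where "W = {v \<in> Xtilde p. \<exists>\<beta>\<in>v E. last \<beta> \<in> G \<and> (\<alpha> @ [last \<beta>], \<beta>) \<in> chain_homotopy E}"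
  show ?thesis
  proof (rule that[of W])
    show "u \<in> W"
      using u \<alpha> G(2) chain_homotopy_repeat_last[OF E ch\<alpha>] by (auto simp: W_def)
  next
    fix v \<beta> assume v: "v \<in> W" "\<beta> \<in> v E"
    then obtain \<gamma> where \<gamma>: "\<gamma> \<in> v E" "last \<gamma> \<in> G" "(\<alpha> @ [last \<gamma>], \<gamma>) \<in> chain_homotopy E" "v \<in> Xtilde p"
      by (auto simp: W_def)
    have h: "(\<gamma>, \<beta>) \<in> chain_homotopy E"
      using Xtilde_class(3)[OF \<gamma>(4) E \<gamma>(1)] v(2) by blast
    have "last \<beta> = last \<gamma>"
      by (rule chain_homotopy_hd_last(2)[OF h])
    then show "(last \<alpha>, last \<beta>) \<in> E \<and> (\<alpha> @ [last \<beta>], \<beta>) \<in> chain_homotopy E"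
      using G(3)[OF \<gamma>(2)] chain_homotopy_trans[OF \<gamma>(3) h] by simp
  next
    show "openin (Xtilde_top p) W"
      unfolding Xtilde_top_def openin_uniform_topology
    proof (intro conjI ballI)
      show "W \<subseteq> Xtilde p" by (auto simp: W_def)
      fix v assume "v \<in> W"
      then obtain \<beta> where v: "v \<in> Xtilde p" and \<beta>: "\<beta> \<in> v E" "last \<beta> \<in> G"
          "(\<alpha> @ [last \<beta>], \<beta>) \<in> chain_homotopy E"
        by (auto simp: W_def)
      have "\<forall>\<^sub>F y in nhds (last \<beta>). y \<in> G"
        by (rule eventually_nhds_in_open[OF G(1) \<beta>(2)])
      then obtain D\<^sub>0 where D\<^sub>0: "D\<^sub>0 \<in> entourages" "\<And>y. (last \<beta>, y) \<in> D\<^sub>0 \<Longrightarrow> y \<in> G"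
        using nhds_entourageE by metis
      have D: "\<Inter>{D\<^sub>0, E} \<in> entourages" "\<Inter>{D\<^sub>0, E} \<subseteq> E"
        using Inter_entourages[of "{D\<^sub>0, E}"] D\<^sub>0(1) E by auto
      show "\<forall>\<^sub>F (v', w) in Xtilde_uniformity p. v' = v \<longrightarrow> w \<in> W"
        using eventually_Xtilde_uniformity[OF E D, of p]
      proof (rule eventually_mono, clarify)
        fix w assume w: "w \<in> Xtilde p" "(v E, w E) \<in> star_entourage p E (\<Inter>{D\<^sub>0, E})"
        obtain \<gamma> where \<gamma>: "chain E \<gamma>" "hd \<gamma> = p" "w E = chain_class E \<gamma>"
          using Xtilde_repr[OF w(1) E] .
        have \<gamma>w: "\<gamma> \<in> w E"
          using \<gamma> chain_homotopy_refl by simp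
        have l: "(last \<beta>, last \<gamma>) \<in> \<Inter>{D\<^sub>0, E}" and h: "(\<beta> @ [last \<gamma>], \<gamma>) \<in> chain_homotopy E"
          using star_entourageD[OF w(2) D(2) \<beta>(1) \<gamma>w] by auto
        have G\<gamma>: "last \<gamma> \<in> G"
          using l D\<^sub>0(2) by simp
        \<comment> \<open>Shorten the two extensions, first to the end of \<open>\<beta>\<close> and then to that of \<open>\<gamma>\<close>, to one.\<close>
        have "chain E (\<alpha> @ [last \<beta>, last \<gamma>])"
          using ch\<alpha> ne G(3)[OF \<beta>(2)] l chain_snoc[of E "\<alpha> @ [last \<beta>]" "last \<gamma>"] by (simp add: chain_snoc)
        then have "(\<alpha> @ [last \<gamma>], (\<alpha> @ [last \<beta>]) @ [last \<gamma>]) \<in> chain_homotopy E"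
          using chain_homotopy_sym[OF chain_homotopy_remove_penultimate[OF _ ne G(3)[OF G\<gamma>]]] by simp
        also have "((\<alpha> @ [last \<beta>]) @ [last \<gamma>], \<beta> @ [last \<gamma>]) \<in> chain_homotopy E"
          by (rule chain_homotopy_snoc[OF \<beta>(3)]) (use l in simp)
        also note h
        finally show "w \<in> W"
          using w(1) \<gamma>w G\<gamma> by (auto simp: W_def)
      qed
    qed
  qed
qed

section \<open>Lifts of paths\<close>

text \<open>
  Continuity in the inverse limit is at least as strong as the local condition on chain lifts; with
  \<open>chain_lift_unique\<close> this yields uniqueness of lifts of paths, also when \<open>X\<close> is not Hausdorff,
  because classes with the same endpoint cannot be close without being equal.
\<close>

lemma pathin_imp_chain_lift:
  assumes L: "pathin (Xtilde_top p) L" and E: "E \<in> entourages"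
    and a: "\<And>t. t \<in> {0..1} \<Longrightarrow> a t \<in> L t E"
  shows "chain_lift E {0..1} (\<lambda>t. Xtilde_proj (L t)) a"
  unfolding chain_lift_def
proof (intro ballI conjI)
  have Lt: "L t \<in> Xtilde p" if "t \<in> {0..1}" for t
    using L that by (auto simp: pathin_def continuous_map_def topspace_Xtilde_top Pi_iff)
  have last_a: "last (a t) = Xtilde_proj (L t)" if "t \<in> {0..1}" for t
    using Xtilde_proj_eq[OF Lt E a] that by simp
  fix t :: real assume t: "t \<in> {0..1}"
  show "chain E (a t)" "last (a t) = Xtilde_proj (L t)"
    using Xtilde_class(1)[OF Lt E a] last_a t by auto
  obtain W where W: "openin (Xtilde_top p) W" "L t \<in> W"
    "\<And>v \<beta>. v \<in> W \<Longrightarrow> \<beta> \<in> v E \<Longrightarrow> (last (a t), last \<beta>) \<in> E \<and> (a t @ [last \<beta>], \<beta>) \<in> chain_homotopy E"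
    using Xtilde_neighbourhood[OF Lt[OF t] E a[OF t]] by blast
  have "openin (top_of_set {0..1}) {s \<in> topspace (top_of_set {0..1}). L s \<in> W}"
    using L W(1) unfolding pathin_def by (rule openin_continuous_map_preimage)
  then obtain T where T: "open T" "{s \<in> {0..1}. L s \<in> W} = {0..1} \<inter> T"
    by (auto simp: openin_open)
  then have "t \<in> T"
    using t W(2) by blast
  have "\<forall>\<^sub>F s in nhds t. s \<in> T"
    by (rule eventually_nhds_in_open[OF T(1) \<open>t \<in> T\<close>])
  then show "\<forall>\<^sub>F s in nhds t. s \<in> {0..1} \<longrightarrow> (Xtilde_proj (L t), Xtilde_proj (L s)) \<in> E \<and>
      (a t @ [Xtilde_proj (L s)], a s) \<in> chain_homotopy E"
  proof (rule eventually_mono, intro impI)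
    fix s assume s: "s \<in> T" "s \<in> {0..1}"
    then have "L s \<in> W"
      using T(2) by blast
    from W(3)[OF this a[OF s(2)]] show "(Xtilde_proj (L t), Xtilde_proj (L s)) \<in> E \<and>
        (a t @ [Xtilde_proj (L s)], a s) \<in> chain_homotopy E"
      using last_a s(2) t by simp
  qed
qed

text \<open>
  The coordinates of a lift are compatible with the bonding maps by uniqueness of chain lifts: for
  \<open>F \<subseteq> E\<close> the chain lift for \<open>F\<close> is also one for \<open>E\<close>.
\<close>

lemma chain_lifts_Xtilde:
  assumes lift: "\<And>E. E \<in> entourages \<Longrightarrow> chain_lift E {0..1} c (a E)"
    and start: "\<And>E. E \<in> entourages \<Longrightarrow> (a E 0, [p]) \<in> chain_homotopy E"
    and hd: "\<And>E t. E \<in> entourages \<Longrightarrow> hd (a E t) = p"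
    and t: "t \<in> {0..1::real}"
  shows "(\<lambda>E\<in>entourages. chain_class E (a E t)) \<in> Xtilde p"
  unfolding Xtilde_def inverse_limit_def
proof (intro CollectI conjI ballI impI)
  show "(\<lambda>E\<in>entourages. chain_class E (a E t)) \<in> Pi\<^sub>E entourages (chain_space p)"
    using chain_liftD(1)[OF lift t] hd by (auto simp: chain_space_def intro!: quotientI)
  fix E F :: "('a \<times> 'a) set" assume EF: "E \<in> entourages" "F \<in> entourages" "F \<subseteq> E"
  have "(a F t, a E t) \<in> chain_homotopy E"
  proof (rule chain_lift_unique[OF EF(1) connected_Icc chain_lift_mono[OF lift[OF EF(2)] EF(3)] lift[OF EF(1)] _ _ t])
    show "(a F 0, a E 0) \<in> chain_homotopy E"
      by (rule chain_homotopy_trans[OF subsetD[OF chain_homotopy_mono[OF EF(3)] start[OF EF(2)]]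
            chain_homotopy_sym[OF start[OF EF(1)]]])
  qed simp
  then show "bond E ((\<lambda>E\<in>entourages. chain_class E (a E t)) F) = (\<lambda>E\<in>entourages. chain_class E (a E t)) E"
    using EF(1,2) bond_chain_class[OF EF(3) chain_liftD(1)[OF lift[OF EF(2)] t]]
      chain_class_eq_iff[OF chain_homotopy_chain(1), of "a F t" "a E t" E "a E t"] by simp
qed

lemma chain_lifts_imp_pathin:
  assumes lift: "\<And>E. E \<in> entourages \<Longrightarrow> chain_lift E {0..1} c (a E)"
    and hd: "\<And>E t. E \<in> entourages \<Longrightarrow> hd (a E t) = p"
    and L: "\<And>t. t \<in> {0..1} \<Longrightarrow> L t \<in> Xtilde p"
      "\<And>t E. t \<in> {0..1} \<Longrightarrow> E \<in> entourages \<Longrightarrow> L t E = chain_class E (a E t)"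
    and cont: "continuous_on {0..1} c"
  shows "pathin (Xtilde_top p) L"
proof -
  have lim: "filterlim (\<lambda>s. (L t, L s)) (Xtilde_uniformity p) (inf (nhds t) (principal {0..1}))"
    if t: "t \<in> {0..1}" for t
    unfolding Xtilde_uniformity_def filterlim_inf filterlim_INF filterlim_filtercomap_iff
      chain_space_uniformity_def filterlim_principal eventually_inf_principal
  proof (intro conjI ballI)
    show "\<forall>\<^sub>F s in nhds t. s \<in> {0..1} \<longrightarrow> (L t, L s) \<in> Xtilde p \<times> Xtilde p"
      using L(1) t by (intro always_eventually) auto
    fix E D :: "('a \<times> 'a) set" assume E: "E \<in> entourages" and "D \<in> {D \<in> entourages. D \<subseteq> E}"
    then have D: "D \<in> entourages" "D \<subseteq> E" by auto
    have "(c \<longlongrightarrow> c t) (at t within {0..1})"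
      using cont t by (simp add: continuous_on)
    from eventually_compose_filterlim[OF eventually_nhds_entourage[OF D(1)] this]
    have "\<forall>\<^sub>F s in nhds t. s \<noteq> t \<longrightarrow> s \<in> {0..1} \<longrightarrow> (c t, c s) \<in> D"
      by (simp add: eventually_at_filter)
    then show "\<forall>\<^sub>F s in nhds t. s \<in> {0..1} \<longrightarrow>
        ((\<lambda>(u, v). (u E, v E)) \<circ> (\<lambda>s. (L t, L s))) s \<in> star_entourage p E D"
      using chain_liftD(3)[OF lift[OF E] t]
    proof eventually_elim
      case (elim s)
      show ?case
      proof
        assume s: "s \<in> {0..1}"
        have "(c t, c s) \<in> D"
          using elim s entourage_refl[OF D(1)] by (cases "s = t") auto
        moreover have "chain_class E (a E t @ [c s]) = chain_class E (a E s)"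
          using elim s chain_class_eq_iff[of E "a E t @ [c s]" "a E s"]
            chain_homotopy_chain(1)[of "a E t @ [c s]" "a E s"] by simp
        ultimately show "((\<lambda>(u, v). (u E, v E)) \<circ> (\<lambda>s. (L t, L s))) s \<in> star_entourage p E D"
          using star_entourage_snoc[OF E D(2) chain_liftD(1)[OF lift[OF E] t] hd[OF E], of "c s"]
            chain_liftD(2)[OF lift[OF E] t] L(2) s t E by simp
      qed
    qed
  qed
  show ?thesis
    unfolding pathin_def continuous_map_def
  proof (intro conjI allI impI)
    show "L \<in> topspace (top_of_set {0..1}) \<rightarrow> topspace (Xtilde_top p)"
      using L(1) by (auto simp: topspace_Xtilde_top)
    fix U assume U: "openin (Xtilde_top p) U"
    show "openin (top_of_set {0..1}) {t \<in> topspace (top_of_set {0..1}). L t \<in> U}"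
    proof (subst openin_subopen, intro ballI)
      fix t assume "t \<in> {t \<in> topspace (top_of_set {0..1}). L t \<in> U}"
      then have t: "t \<in> {0..1}" "L t \<in> U" by auto
      have "\<forall>\<^sub>F (x', y) in Xtilde_uniformity p. x' = L t \<longrightarrow> y \<in> U"
        using U t(2) unfolding Xtilde_top_def openin_uniform_topology by blast
      from eventually_compose_filterlim[OF this lim[OF t(1)]]
      have "\<forall>\<^sub>F s in nhds t. s \<in> {0..1} \<longrightarrow> L s \<in> U"
        by (simp add: eventually_inf_principal)
      then obtain T where "open T" "t \<in> T" "\<And>s. s \<in> T \<Longrightarrow> s \<in> {0..1} \<Longrightarrow> L s \<in> U"
        by (auto simp: eventually_nhds)
      then show "\<exists>T. openin (top_of_set {0..1}) T \<and> t \<in> T \<and>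
          T \<subseteq> {t \<in> topspace (top_of_set {0..1}). L t \<in> U}"
        using t by (intro exI[of _ "{0..1} \<inter> T"]) (auto simp: openin_open)
    qed
  qed
qed

text \<open>
  Existence and uniqueness of lifts show that the definite description in \<open>lift_path\<close> denotes the
  lift. Its last clause is the working tool: each coordinate of the lift can be computed from any
  chain lift that starts at the constant class.
\<close>

lemma lift_path:
  fixes p :: "'a::uniform_space"
  assumes cont: "continuous_on {0..1} c" and c0: "c 0 = p"
  shows pathin_lift_path: "pathin (Xtilde_top p) (lift_path p c)"
    and lift_path_0: "lift_path p c 0 = Xtilde_base p"
    and lift_path_eq_chain_class: "\<And>E b t. E \<in> entourages \<Longrightarrow> chain_lift E {0..1} c b \<Longrightarrow>
      (b 0, [p]) \<in> chain_homotopy E \<Longrightarrow> t \<in> {0..1} \<Longrightarrow> lift_path p c t E = chain_class E (b t)"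
proof -
  have "\<forall>E\<in>entourages. \<exists>a. chain_lift E {0..1} c a \<and> (a 0, [p]) \<in> chain_homotopy E \<and> (\<forall>t. hd (a t) = p)"
  proof
    fix E :: "('a \<times> 'a) set" assume "E \<in> entourages"
    from chain_lift_exists[OF this cont] show "\<exists>a. chain_lift E {0..1} c a \<and> (a 0, [p]) \<in> chain_homotopy E \<and> (\<forall>t. hd (a t) = p)"
      using c0 by metis
  qed
  from bchoice[OF this] obtain a where
    "\<forall>E\<in>entourages. chain_lift E {0..1} c (a E) \<and> (a E 0, [p]) \<in> chain_homotopy E \<and> (\<forall>t. hd (a E t) = p)"
    by blast
  then have a: "\<And>E. E \<in> entourages \<Longrightarrow> chain_lift E {0..1} c (a E)"
    "\<And>E. E \<in> entourages \<Longrightarrow> (a E 0, [p]) \<in> chain_homotopy E"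
    "\<And>E t. E \<in> entourages \<Longrightarrow> hd (a E t) = p"
    by auto
  define L where "L = (\<lambda>t\<in>{0..1}. \<lambda>E\<in>entourages. chain_class E (a E t))"
  have L_Xtilde: "L t \<in> Xtilde p" if "t \<in> {0..1}" for t
    using chain_lifts_Xtilde[of c a p t] a that by (simp add: L_def)
  have L_eq: "L t E = chain_class E (a E t)" if "t \<in> {0..1}" "E \<in> entourages" for t E
    using that by (simp add: L_def)
  have L_path: "pathin (Xtilde_top p) L"
    by (rule chain_lifts_imp_pathin[OF a(1,3) L_Xtilde L_eq cont])
  have L_0: "L 0 = Xtilde_base p"
    unfolding L_def Xtilde_base_def
    using chain_class_eqI[OF a(2)] by (simp add: restrict_def fun_eq_iff)
  have L_proj: "Xtilde_proj (L t) = c t" if t: "t \<in> {0..1}" for t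
  proof -
    note aU = chain_liftD(1,2)[OF a(1)[OF UNIV_entourage] t]
    have "a UNIV t \<in> L t UNIV"
      using chain_homotopy_refl[OF aU(1)] L_eq[OF t UNIV_entourage] by simp
    from Xtilde_proj_eq[OF L_Xtilde[OF t] UNIV_entourage this] show ?thesis
      using aU by simp
  qed
  have lift_L: "lift_path p c = L"
    unfolding lift_path_def
  proof (rule the_equality)
    show "L \<in> extensional {0..1} \<and> pathin (Xtilde_top p) L \<and> L 0 = Xtilde_base p \<and>
        (\<forall>t\<in>{0..1}. Xtilde_proj (L t) = c t)"
      using L_path L_0 L_proj by (simp add: L_def)
  next
    fix M assume "M \<in> extensional {0..1} \<and> pathin (Xtilde_top p) M \<and> M 0 = Xtilde_base p \<and>
        (\<forall>t\<in>{0..1}. Xtilde_proj (M t) = c t)"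
    then have M: "M \<in> extensional {0..1}" "pathin (Xtilde_top p) M" "M 0 = Xtilde_base p"
        "\<And>t. t \<in> {0..1} \<Longrightarrow> Xtilde_proj (M t) = c t" by auto
    have M_Xtilde: "M t \<in> Xtilde p" if "t \<in> {0..1}" for t
      using M(2) that by (auto simp: pathin_def continuous_map_def topspace_Xtilde_top Pi_iff)
    have eq: "M t E = L t E" if t: "t \<in> {0..1}" and E: "E \<in> entourages" for t E
    proof -
      \<comment> \<open>Any choice of representatives of a competing lift \<open>M\<close> is a chain lift of \<open>c\<close>.\<close>
      define b where "b s = (SOME \<beta>. \<beta> \<in> M s E)" for s
      have b: "b s \<in> M s E" if s: "s \<in> {0..1}" for s
      proof -
        obtain \<beta> where "chain E \<beta>" "M s E = chain_class E \<beta>"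
          using Xtilde_repr[OF M_Xtilde[OF s] E] by metis
        then have "\<beta> \<in> M s E"
          using chain_homotopy_refl by simp
        then show ?thesis
          unfolding b_def by (rule someI)
      qed
      have "chain_lift E {0..1} (\<lambda>t. Xtilde_proj (M t)) b"
        by (rule pathin_imp_chain_lift[OF M(2) E b])
      then have lift_b: "chain_lift E {0..1} c b"
        by (rule chain_lift_cong) (use M(4) in auto)
      have "([p], b 0) \<in> chain_homotopy E"
        using b[of 0] E by (simp add: M(3) Xtilde_base_def)
      then have "(b 0, a E 0) \<in> chain_homotopy E"
        by (rule chain_homotopy_sym[OF chain_homotopy_trans[OF a(2)[OF E]]])
      then have "(b t, a E t) \<in> chain_homotopy E"
        using chain_lift_unique[OF E connected_Icc lift_b a(1)[OF E] _ _ t, of 0] by simp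
      then show ?thesis
        using Xtilde_class(3)[OF M_Xtilde[OF t] E b[OF t]] L_eq[OF t E] chain_class_eqI by simp
    qed
    show "M = L"
    proof (rule extensionalityI[OF M(1)])
      show "L \<in> extensional {0..1}" by (simp add: L_def)
      fix t :: real assume t: "t \<in> {0..1}"
      show "M t = L t"
      proof (rule extensionalityI[of _ entourages])
        show "M t \<in> extensional entourages" "L t \<in> extensional entourages"
          using M_Xtilde[OF t] L_Xtilde[OF t] by (auto simp: Xtilde_def inverse_limit_def PiE_def)
      qed (rule eq[OF t])
    qed
  qed
  show "pathin (Xtilde_top p) (lift_path p c)" "lift_path p c 0 = Xtilde_base p"
    using L_path L_0 lift_L by simp_all
  fix E :: "('a \<times> 'a) set" and b and t :: real
  assume E: "E \<in> entourages" and b: "chain_lift E {0..1} c b" "(b 0, [p]) \<in> chain_homotopy E" and t: "t \<in> {0..1}"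
  have "(a E 0, b 0) \<in> chain_homotopy E"
    by (rule chain_homotopy_trans[OF a(2)[OF E] chain_homotopy_sym[OF b(2)]])
  then have "(a E t, b t) \<in> chain_homotopy E"
    using chain_lift_unique[OF E connected_Icc a(1)[OF E] b(1) _ _ t, of 0] by simp
  then show "lift_path p c t E = chain_class E (b t)"
    using L_eq[OF t E] chain_class_eqI by (simp add: lift_L)
qed

lemma lift_path_Xtilde:
  assumes "continuous_on {0..1} c" "c 0 = p" "t \<in> {0..1}"
  shows "lift_path p c t \<in> Xtilde p"
  using pathin_lift_path[OF assms(1,2)] assms(3)
  by (auto simp: pathin_def continuous_map_def topspace_Xtilde_top Pi_iff)

lemma lift_path_cong:
  assumes "\<And>t. t \<in> {0..1} \<Longrightarrow> c t = d t"
  shows "lift_path p c = lift_path p d"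
  unfolding lift_path_def using assms by simp

section \<open>Homotopy invariance of the lifted endpoint\<close>

text \<open>
  A chain lift of \<open>c\<close> also lifts every uniformly close map \<open>d\<close>: jump from the end \<open>c t\<close> to \<open>d t\<close>.
\<close>

lemma chain_lift_transfer:
  fixes c d :: "real \<Rightarrow> 'a::uniform_space"
  assumes E: "E \<in> entourages" and a: "chain_lift E S c a" and \<eta>: "\<eta> > 0"
    and close: "\<And>s t. s \<in> S \<Longrightarrow> t \<in> S \<Longrightarrow> dist s t < \<eta> \<Longrightarrow> (c s, d t) \<in> E \<and> (d s, d t) \<in> E"
  shows "chain_lift E S d (\<lambda>t. a t @ [d t])"
  unfolding chain_lift_def
proof (intro ballI conjI)
  fix t assume t: "t \<in> S"
  note at = chain_liftD[OF a t]
  have ne: "a t \<noteq> []"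
    using at(1) by (simp add: chain_def)
  show ch: "chain E (a t @ [d t])"
    using close[OF t t] \<eta> at by (simp add: chain_snoc)
  show "last (a t @ [d t]) = d t" by simp
  have "\<forall>\<^sub>F s in nhds t. dist s t < \<eta>"
    using \<eta> by (auto simp: eventually_nhds_metric)
  with at(3) show "\<forall>\<^sub>F s in nhds t. s \<in> S \<longrightarrow> (d t, d s) \<in> E \<and>
      ((a t @ [d t]) @ [d s], a s @ [d s]) \<in> chain_homotopy E"
  proof eventually_elim
    case (elim s)
    show ?case
    proof
      assume s: "s \<in> S"
      have cl: "(c t, d s) \<in> E" "(d t, d s) \<in> E" "(c s, d s) \<in> E"
        using close[OF t s] close[OF s s] elim(2) \<eta> by (auto simp: dist_commute)
      have h: "(a t @ [c s], a s) \<in> chain_homotopy E"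
        using elim(1) s by simp
      have "((a t @ [d t]) @ [d s], a t @ [d s]) \<in> chain_homotopy E"
        using chain_homotopy_remove_penultimate[of E "a t" "d t" "d s"] cl ne ch at(2)
          chain_snoc[of E "a t @ [d t]" "d s"] by simp
      also have "(a t @ [d s], (a t @ [c s]) @ [d s]) \<in> chain_homotopy E"
        using chain_homotopy_sym[OF chain_homotopy_remove_penultimate[of E "a t" "c s" "d s"]] cl ne at(2)
          chain_homotopy_chain(1)[OF h] chain_snoc[of E "a t @ [c s]" "d s"] by simp
      also have "((a t @ [c s]) @ [d s], a s @ [d s]) \<in> chain_homotopy E"
        by (rule chain_homotopy_snoc[OF h]) (use cl in simp)
      finally show "(d t, d s) \<in> E \<and> ((a t @ [d t]) @ [d s], a s @ [d s]) \<in> chain_homotopy E"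
        using cl(2) by simp
    qed
  qed
qed

text \<open>
  Fix an entourage. For neighbouring stages of the homotopy, \<open>chain_lift_transfer\<close> obtains the lift of
  one path from the lift of the other by appending its current point. At time 1 both paths have the
  same end, so the appended point repeats the last one and the class is unchanged. The lifted
  endpoint is thus locally constant in the homotopy parameter.
\<close>

lemma lift_path_homotopic:
  fixes c d :: "real \<Rightarrow> 'a::uniform_space"
  assumes hom: "homotopic_paths UNIV c d" and c0: "c 0 = p"
  shows "lift_path p c 1 = lift_path p d 1"
proof -
  obtain h :: "real \<times> real \<Rightarrow> 'a" where h: "continuous_on ({0..1} \<times> {0..1}) h"
      "\<And>t. t \<in> {0..1} \<Longrightarrow> h (0, t) = c t" "\<And>t. t \<in> {0..1} \<Longrightarrow> h (1, t) = d t"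
      "\<And>s. s \<in> {0..1} \<Longrightarrow> h (s, 0) = c 0" "\<And>s. s \<in> {0..1} \<Longrightarrow> h (s, 1) = c 1"
    using hom unfolding homotopic_paths pathstart_def pathfinish_def o_def by blast
  define k where "k s = (\<lambda>t. h (s, t))" for s
  have k: "continuous_on {0..1} (k s)" "k s 0 = p" if "s \<in> {0..1}" for s
    unfolding k_def using that h(4) c0
    by (auto intro!: continuous_on_compose2[OF h(1)] continuous_on_Pair continuous_on_const continuous_on_id)
  have const: "lift_path p (k 0) 1 E = lift_path p (k 1) 1 E" if E: "E \<in> entourages" for E
  proof (rule connected_local_const[of "{0..1::real}" 0 1 "\<lambda>s. lift_path p (k s) 1 E"])
    obtain \<delta> where \<delta>: "\<delta> > 0"
      "\<And>x y. x \<in> {0..1} \<times> {0..1} \<Longrightarrow> y \<in> {0..1} \<times> {0..1} \<Longrightarrow> dist x y < \<delta> \<Longrightarrow> (h x, h y) \<in> E"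
      using compact_uniformly_continuous_entourage[OF compact_Times[OF compact_Icc compact_Icc] h(1) E]
      by metis
    show "\<forall>s\<in>{0..1}. \<forall>\<^sub>F s' in at s within {0..1}. lift_path p (k s) 1 E = lift_path p (k s') 1 E"
    proof
      fix s :: real assume s: "s \<in> {0..1}"
      obtain a where a: "chain_lift E {0..1} (k s) a" "(a 0, [p]) \<in> chain_homotopy E"
        using chain_lift_exists[OF E k(1)[OF s]] k(2)[OF s] by metis
      have "\<forall>\<^sub>F s' in nhds s. dist s' s < \<delta> / 2"
        unfolding eventually_nhds_metric by (rule exI[of _ "\<delta> / 2"]) (use \<delta>(1) in auto)
      then show "\<forall>\<^sub>F s' in at s within {0..1}. lift_path p (k s) 1 E = lift_path p (k s') 1 E"
        unfolding eventually_at_filter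
      proof (rule eventually_mono, intro impI)
        fix s' assume s': "dist s' s < \<delta> / 2" "s' \<in> {0..1}"
        have close: "(k s t, k s' t') \<in> E \<and> (k s' t, k s' t') \<in> E"
          if t: "t \<in> {0..1}" "t' \<in> {0..1}" "dist t t' < \<delta> / 2" for t t'
        proof -
          have "dist (s, t) (s', t') \<le> dist s s' + dist t t'"
            unfolding dist_Pair_Pair by (rule sqrt_sum_squares_le_sum) simp_all
          also have "\<dots> < \<delta>"
            using t(3) s'(1) by (simp add: dist_commute)
          finally have "(h (s, t), h (s', t')) \<in> E"
            using \<delta>(2) s s'(2) t by auto
          moreover have "dist (s', t) (s', t') < \<delta>"
            using t(3) \<delta>(1) by (simp add: dist_Pair_Pair)
          then have "(h (s', t), h (s', t')) \<in> E"
            using \<delta>(2) s'(2) t by auto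
          ultimately show ?thesis by (simp add: k_def)
        qed
        have b: "chain_lift E {0..1} (k s') (\<lambda>t. a t @ [k s' t])"
          by (rule chain_lift_transfer[OF E a(1), of "\<delta> / 2"]) (use \<delta>(1) close in auto)
        have last: "last (a 0) = k s' 0" "last (a 1) = k s' 1"
          using chain_liftD(2)[OF a(1)] s s'(2) h(4,5) by (auto simp: k_def)
        have "(a 0 @ [k s' 0], a 0) \<in> chain_homotopy E"
          using chain_homotopy_repeat_last[OF E chain_liftD(1)[OF a(1)], of 0] last by simp
        also note a(2)
        finally have "lift_path p (k s') 1 E = chain_class E (a 1 @ [k s' 1])"
          using lift_path_eq_chain_class[OF k[OF s'(2)] E b] by simp
        also have "\<dots> = chain_class E (a 1)"
          using chain_class_eqI[OF chain_homotopy_repeat_last[OF E chain_liftD(1)[OF a(1)], of 1]] last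
          by simp
        also have "\<dots> = lift_path p (k s) 1 E"
          using lift_path_eq_chain_class[OF k[OF s] E a] by simp
        finally show "lift_path p (k s) 1 E = lift_path p (k s') 1 E" ..
      qed
    qed
  qed simp_all
  have "lift_path p (k s) 1 \<in> extensional entourages" if "s \<in> {0..1}" for s
    using lift_path_Xtilde[OF k[OF that], of 1] by (auto simp: Xtilde_def inverse_limit_def PiE_def)
  then have "lift_path p (k 0) 1 = lift_path p (k 1) 1"
    using const by (intro extensionalityI[of _ entourages]) auto
  moreover have "lift_path p (k 0) = lift_path p c" "lift_path p (k 1) = lift_path p d"
    using h(2,3) by (auto intro!: lift_path_cong simp: k_def)
  ultimately show ?thesis by simp
qed

text \<open>
  Homotopy invariance makes \<open>lambda_hom\<close> well defined, hence computable on any representative.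
\<close>

lemma lambda_hom_eq:
  assumes "path c" "c 0 = p"
  shows "lambda_hom p ({(c, d). homotopic_paths UNIV c d} `` {c}) = lift_path p c 1"
  unfolding lambda_hom_def
proof (rule the_equality)
  show "\<forall>d\<in>{(c, d). homotopic_paths UNIV c d} `` {c}. lift_path p d 1 = lift_path p c 1"
    using lift_path_homotopic[of c _ p] assms(2) by auto
next
  fix u assume u: "\<forall>d\<in>{(c, d). homotopic_paths UNIV c d} `` {c}. lift_path p d 1 = u"
  have "homotopic_paths UNIV c c"
    using assms(1) by simp
  with u show "u = lift_path p c 1"
    by auto
qed

section \<open>Density\<close>

text \<open>
  Consecutive points of the chain are joined inside the ball around the earlier one, which is
  path connected. The chain is parametrized by an interval of integer length so that extending it by a
  point does not disturb the earlier parametrization.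
\<close>

lemma path_along_chain:
  fixes \<alpha> :: "'a::uniform_space list"
  assumes F: "F \<in> entourages" "\<And>x. path_connected (eball x F)" and \<alpha>: "chain F \<alpha>"
  obtains c where "continuous_on {0..real (length \<alpha> - 1)} c" "map (\<lambda>i. c (real i)) [0..<length \<alpha>] = \<alpha>"
    "\<And>k t. k < length \<alpha> - 1 \<Longrightarrow> t \<in> {real k..real k + 1} \<Longrightarrow> (c (real k), c t) \<in> F"
proof -
  have "\<exists>c. continuous_on {0..real (length \<alpha> - 1)} c \<and> map (\<lambda>i. c (real i)) [0..<length \<alpha>] = \<alpha> \<and>
    (\<forall>k < length \<alpha> - 1. \<forall>t \<in> {real k..real k + 1}. (c (real k), c t) \<in> F)"
    using \<alpha>
  proof (induction \<alpha> rule: rev_induct)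
    case Nil
    then show ?case by (simp add: chain_def)
  next
    case (snoc y \<beta>)
    show ?case
    proof (cases "\<beta> = []")
      case True
      then show ?thesis by (intro exI[of _ "\<lambda>_. y"]) simp
    next
      case False
      define n where "n = length \<beta> - 1"
      have n: "length \<beta> = Suc n"
        using False by (simp add: n_def)
      have \<beta>: "chain F \<beta>" "(last \<beta>, y) \<in> F"
        using snoc.prems False by (simp_all add: chain_snoc)
      obtain c where c: "continuous_on {0..real n} c"
          "map (\<lambda>i. c (real i)) [0..<Suc n] = \<beta>"
          "\<And>k t. k < n \<Longrightarrow> t \<in> {real k..real k + 1} \<Longrightarrow> (c (real k), c t) \<in> F"
        using snoc.IH[OF \<beta>(1), unfolded n diff_Suc_1] by blast
      have last: "last \<beta> = c (real n)"
        by (simp flip: c(2))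
      have "c (real n) \<in> eball (c (real n)) F" "y \<in> eball (c (real n)) F"
        using entourage_refl[OF F(1)] \<beta>(2) last by (auto simp: eball_def)
      then obtain g where g: "path g" "path_image g \<subseteq> eball (c (real n)) F" "g 0 = c (real n)" "g 1 = y"
        using F(2)[of "c (real n)"] unfolding path_connected_def pathstart_def pathfinish_def by blast
      have gF: "(c (real n), g t) \<in> F" if "t \<in> {0..1}" for t
        using imageI[OF that, of g] g(2) unfolding path_image_def eball_def by blast
      define c' where "c' t = (if t \<le> real n then c t else g (t - real n))" for t
      have "continuous_on {0..real (Suc n)} c'"
        unfolding c'_def
      proof (rule continuous_on_cases_le)
        show "continuous_on {t \<in> {0..real (Suc n)}. t \<le> real n} c"
          by (rule continuous_on_subset[OF c(1)]) auto
        show "continuous_on {t \<in> {0..real (Suc n)}. real n \<le> t} (\<lambda>t. g (t - real n))"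
          by (rule continuous_on_compose2[OF g(1)[unfolded path_def]])
            (auto intro: continuous_on_diff continuous_on_id continuous_on_const)
      qed (use g(3) in \<open>auto intro: continuous_on_id\<close>)
      moreover have "map (\<lambda>i. c' (real i)) [0..<Suc (Suc n)] = \<beta> @ [y]"
      proof -
        have "map (\<lambda>i. c' (real i)) [0..<Suc n] = map (\<lambda>i. c (real i)) [0..<Suc n]"
          by (rule map_cong) (auto simp: c'_def)
        moreover have "c' (real (Suc n)) = y"
          using g(4) by (simp add: c'_def)
        moreover have "map (\<lambda>i. c' (real i)) [0..<Suc (Suc n)]
            = map (\<lambda>i. c' (real i)) [0..<Suc n] @ [c' (real (Suc n))]"
          by simp
        ultimately show ?thesis
          by (simp only: c(2))
      qed
      moreover have "(c' (real k), c' t) \<in> F" if kt: "k < Suc n" "t \<in> {real k..real k + 1}" for k t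
      proof (cases "k < n")
        case True
        then have "real k + 1 \<le> real n" by linarith
        then have "t \<le> real n" "real k \<le> real n" using kt by auto
        then show ?thesis using c(3)[OF True kt(2)] by (simp add: c'_def)
      next
        case False
        then have k: "k = n" using kt by simp
        have "c' t = g (t - real n)"
          using kt g(3) by (auto simp: c'_def k)
        then show ?thesis
          using gF[of "t - real n"] kt by (simp add: k c'_def)
      qed
      ultimately show ?thesis
        by (intro exI[of _ c']) (simp add: n)
    qed
  qed
  then show ?thesis using that by blast
qed

text \<open>
  The decisive point: a path following the chain \<open>\<alpha>\<close> inside \<open>F\<close>-balls lifts, at the entourage
  \<open>F\<close> itself, exactly to the class of \<open>\<alpha>\<close>.
\<close>

lemma path_lifting_to_chain:
  fixes \<alpha> :: "'a::uniform_space list"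
  assumes F: "F \<in> entourages" "\<And>x. path_connected (eball x F)" and \<alpha>: "chain F \<alpha>" "hd \<alpha> = p"
  obtains c where "path c" "c 0 = p" "c 1 = last \<alpha>" "lift_path p c 1 F = chain_class F \<alpha>"
proof -
  define n where "n = length \<alpha> - 1"
  have n: "length \<alpha> = Suc n"
    using \<alpha>(1) by (cases \<alpha>) (auto simp: n_def chain_def)
  obtain c where c: "continuous_on {0..real n} c" "map (\<lambda>i. c (real i)) [0..<Suc n] = \<alpha>"
    "\<And>k t. k < n \<Longrightarrow> t \<in> {real k..real k + 1} \<Longrightarrow> (c (real k), c t) \<in> F"
    using path_along_chain[OF F \<alpha>(1), unfolded n diff_Suc_1] by blast
  have ends: "c 0 = p" "c (real n) = last \<alpha>"
  proof -
    have "hd (map (\<lambda>i. c (real i)) [0..<Suc n]) = c 0"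
      by (simp add: hd_map del: upt_Suc)
    then show "c 0 = p" using c(2) \<alpha>(2) by simp
    show "c (real n) = last \<alpha>" by (simp flip: c(2))
  qed
  define b where "b t = map (\<lambda>i. c (real i)) [0..<Suc (nat \<lfloor>t\<rfloor>)] @ [c t]" for t
  define f where "f t = real n * t" for t
  have f: "continuous_on {0..1} f" "f ` {0..1} \<subseteq> {0..real n}"
    unfolding f_def by (auto intro: continuous_on_mult_left continuous_on_id simp: mult_left_le)
  have "chain_lift F {0..real n} c b"
    unfolding b_def by (rule chain_lift_grid[OF F(1) c(1,3)])
  then have lift: "chain_lift F {0..1} (c \<circ> f) (b \<circ> f)"
    by (rule chain_lift_compose[OF _ f])
  have start: "((b \<circ> f) 0, [p]) \<in> chain_homotopy F"
    using chain_homotopy_repeat_last[OF F(1), of "[p]"] by (simp add: b_def f_def ends chain_def)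
  have finish: "((b \<circ> f) 1, \<alpha>) \<in> chain_homotopy F"
    using chain_homotopy_repeat_last[OF F(1) \<alpha>(1)] c(2) by (simp add: b_def f_def ends(2) del: upt_Suc)
  have cont: "continuous_on {0..1} (c \<circ> f)"
    by (rule continuous_on_compose[OF f(1) continuous_on_subset[OF c(1) f(2)]])
  show ?thesis
  proof (rule that[of "c \<circ> f"])
    show "path (c \<circ> f)" using cont by (simp add: path_def)
    show c0: "(c \<circ> f) 0 = p" and "(c \<circ> f) 1 = last \<alpha>"
      using ends by (simp_all add: f_def)
    show "lift_path p (c \<circ> f) 1 F = chain_class F \<alpha>"
      using lift_path_eq_chain_class[OF cont c0 F(1) lift start, of 1] chain_class_eqI[OF finish] by simp
  qed
qed

lemma Xtilde_eq_mono:
  assumes "u \<in> Xtilde p" "v \<in> Xtilde p" "E \<in> entourages" "F \<in> entourages" "F \<subseteq> E" "u F = v F"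
  shows "u E = v E"
  using Xtilde_bond[OF assms(1,3-5)] Xtilde_bond[OF assms(2,3-5)] assms(6) by simp

text \<open>
  A basic entourage of the inverse limit restricts only finitely many coordinates, and all of these are
  determined by the coordinate at the intersection \<open>F\<close> of the indices. So points that agree at \<open>F\<close>
  are close in the sense of \<open>P\<close>. This turns density into exact agreement at a single coordinate.
\<close>

lemma Xtilde_uniformity_coordinate:
  fixes p :: "'a::uniform_space"
  assumes "eventually P (Xtilde_uniformity p)"
  obtains F where "F \<in> entourages" "\<And>u v. u \<in> Xtilde p \<Longrightarrow> v \<in> Xtilde p \<Longrightarrow> u F = v F \<Longrightarrow> P (u, v)"
proof -
  let ?\<Phi> = "\<lambda>E. filtercomap (\<lambda>(u, v). (u E, v E)) (chain_space_uniformity p E)"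
  have "eventually (\<lambda>z. z \<in> Xtilde p \<times> Xtilde p \<longrightarrow> P z) (INF E \<in> entourages. ?\<Phi> E)"
    using assms unfolding Xtilde_uniformity_def eventually_inf_principal .
  then obtain \<E> where \<E>: "\<E> \<subseteq> entourages" "finite \<E>"
      "eventually (\<lambda>z. z \<in> Xtilde p \<times> Xtilde p \<longrightarrow> P z) (INF E \<in> \<E>. ?\<Phi> E)"
    unfolding eventually_INF[of _ _ entourages] by blast
  define F where "F = \<Inter>\<E>"
  have F: "F \<in> entourages"
    unfolding F_def using \<E> by (intro Inter_entourages)
  define R where "R = {(u, v). u \<in> Xtilde p \<and> v \<in> Xtilde p \<and> u F = v F}"
  have "principal R \<le> ?\<Phi> E" if "E \<in> \<E>" for E
  proof -
    have E: "E \<in> entourages" "F \<subseteq> E"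
      using that \<E>(1) by (auto simp: F_def)
    have "(u E, v E) \<in> star_entourage p E D"
      if uv: "(u, v) \<in> R" and D: "D \<in> entourages" "D \<subseteq> E" for u v D
    proof -
      obtain \<alpha> where \<alpha>: "chain E \<alpha>" "hd \<alpha> = p" "u E = chain_class E \<alpha>"
        using Xtilde_repr[of u p E] uv E(1) by (auto simp: R_def)
      have "v E = u E"
        using uv Xtilde_eq_mono[of v p u E F] E F by (auto simp: R_def)
      moreover have "(chain_class E \<alpha>, chain_class E (\<alpha> @ [last \<alpha>])) \<in> star_entourage p E D"
        by (rule star_entourage_snoc[OF E(1) D(2) \<alpha>(1,2) entourage_refl[OF D(1)]])
      ultimately show ?thesis
        using chain_class_eqI[OF chain_homotopy_repeat_last[OF E(1) \<alpha>(1)]] \<alpha>(3) by simp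
    qed
    then have "filterlim (\<lambda>(u, v). (u E, v E)) (chain_space_uniformity p E) (principal R)"
      unfolding chain_space_uniformity_def filterlim_INF filterlim_principal eventually_principal by auto
    then show ?thesis
      by (simp add: filterlim_iff_le_filtercomap)
  qed
  then have "principal R \<le> (INF E \<in> \<E>. ?\<Phi> E)"
    by (rule INF_greatest)
  from filter_leD[OF this \<E>(3)] have "\<forall>z\<in>R. z \<in> Xtilde p \<times> Xtilde p \<longrightarrow> P z"
    by (simp add: eventually_principal)
  with F show ?thesis
    by (intro that[of F]) (auto simp: R_def)
qed

lemma Xtilde_basepoint_component_dense:
  fixes p :: "'a::uniform_space"
  assumes "uniformly_locally_path_connected TYPE('a)"
  shows "Xtilde_top p closure_of path_component_of_set (Xtilde_top p) (Xtilde_base p) = Xtilde p"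
proof
  show "Xtilde_top p closure_of path_component_of_set (Xtilde_top p) (Xtilde_base p) \<subseteq> Xtilde p"
    using closure_of_subset_topspace topspace_Xtilde_top by metis
  show "Xtilde p \<subseteq> Xtilde_top p closure_of path_component_of_set (Xtilde_top p) (Xtilde_base p)"
  proof
    fix u assume u: "u \<in> Xtilde p"
    have "\<exists>v. v \<in> path_component_of_set (Xtilde_top p) (Xtilde_base p) \<and> v \<in> T"
      if T: "u \<in> T" "openin (Xtilde_top p) T" for T
    proof -
      have *: "\<forall>\<^sub>F (x', y) in Xtilde_uniformity p. x' = u \<longrightarrow> y \<in> T"
        using T unfolding Xtilde_top_def openin_uniform_topology by blast
      obtain E where E: "E \<in> entourages"
          "\<And>u' v. u' \<in> Xtilde p \<Longrightarrow> v \<in> Xtilde p \<Longrightarrow> u' E = v E \<Longrightarrow>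
            case (u', v) of (x', y) \<Rightarrow> x' = u \<longrightarrow> y \<in> T"
        using Xtilde_uniformity_coordinate[OF *] by blast
      obtain F where F: "F \<in> entourages" "F \<subseteq> E" "\<And>x. path_connected (eball x F)"
        using assms E(1) unfolding uniformly_locally_path_connected_def by blast
      obtain \<alpha> where \<alpha>: "chain F \<alpha>" "hd \<alpha> = p" "u F = chain_class F \<alpha>"
        using Xtilde_repr[OF u F(1)] .
      obtain c where c: "path c" "c 0 = p" "lift_path p c 1 F = chain_class F \<alpha>"
        using path_lifting_to_chain[OF F(1,3) \<alpha>(1,2)] by metis
      note c' = c(1)[unfolded path_def] c(2)
      have v: "lift_path p c 1 \<in> Xtilde p"
        by (rule lift_path_Xtilde[OF c']) simp
      have "u E = lift_path p c 1 E"
        by (rule Xtilde_eq_mono[OF u v E(1) F(1,2)]) (simp add: c(3) \<alpha>(3))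
      then have "lift_path p c 1 \<in> T"
        using E(2)[OF u v] by simp
      moreover have "path_component_of (Xtilde_top p) (Xtilde_base p) (lift_path p c 1)"
        unfolding path_component_of_def
        using pathin_lift_path[OF c'] lift_path_0[OF c'] by blast
      ultimately show ?thesis by blast
    qed
    with u show "u \<in> Xtilde_top p closure_of path_component_of_set (Xtilde_top p) (Xtilde_base p)"
      by (simp add: in_closure_of topspace_Xtilde_top)
  qed
qed

text \<open>
  All coordinates of a point have the same endpoint, so they consist of loops as soon as one of them
  ends at \<open>p\<close>.
\<close>

lemma delta1_iff: "u \<in> delta1 p \<longleftrightarrow> u \<in> Xtilde p \<and> Xtilde_proj u = p"
proof
  assume u: "u \<in> delta1 p"
  then have "u E \<in> chain_space p E" if "E \<in> entourages" for E
    using that by (fastforce simp: delta1_def inverse_limit_def loop_classes_def chain_space_def quotient_def)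
  with u have uX: "u \<in> Xtilde p"
    by (auto simp: delta1_def Xtilde_def inverse_limit_def PiE_iff)
  have "u UNIV \<in> loop_classes p UNIV"
    using u UNIV_entourage by (auto simp: delta1_def inverse_limit_def)
  then obtain \<alpha> where "chain UNIV \<alpha>" "last \<alpha> = p" "u UNIV = chain_class UNIV \<alpha>"
    by (auto simp: loop_classes_def elim!: quotientE)
  with uX show "u \<in> Xtilde p \<and> Xtilde_proj u = p"
    using class_end_chain_class[of UNIV \<alpha>] by (simp add: Xtilde_proj_def)
next
  assume u: "u \<in> Xtilde p \<and> Xtilde_proj u = p"
  have "u E \<in> loop_classes p E" if E: "E \<in> entourages" for E
  proof -
    obtain \<alpha> where \<alpha>: "chain E \<alpha>" "hd \<alpha> = p" "u E = chain_class E \<alpha>"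
      using Xtilde_repr[of u p E] u E by blast
    moreover have "last \<alpha> = p"
      using Xtilde_proj_eq[of u p E \<alpha>] u E \<alpha> chain_homotopy_refl[OF \<alpha>(1)] by auto
    ultimately show ?thesis
      by (auto simp: loop_classes_def intro: quotientI)
  qed
  with u show "u \<in> delta1 p"
    by (auto simp: delta1_def Xtilde_def inverse_limit_def PiE_iff)
qed

text \<open>
  As for \<open>Xtilde_uniformity_coordinate\<close>, but for the product of the discrete topologies.
\<close>

lemma delta1_neighbourhood:
  fixes p :: "'a::uniform_space"
  assumes "openin (delta1_top p) T" "u \<in> T"
  obtains F where "F \<in> entourages" "\<And>v. v \<in> delta1 p \<Longrightarrow> v F = u F \<Longrightarrow> v \<in> T"
proof -
  obtain S where S: "openin (product_topology (\<lambda>E. discrete_topology (loop_classes p E)) entourages) S"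
      "T = S \<inter> delta1 p"
    using assms(1) unfolding delta1_top_def openin_subtopology by blast
  obtain U where U: "finite {E \<in> entourages. U E \<noteq> loop_classes p E}" "u \<in> Pi\<^sub>E entourages U"
      "Pi\<^sub>E entourages U \<subseteq> S"
    using S assms(2) unfolding openin_product_topology_alt by force
  define \<E> where "\<E> = {E \<in> entourages. U E \<noteq> loop_classes p E}"
  have F: "\<Inter>\<E> \<in> entourages"
    using U(1) by (intro Inter_entourages) (auto simp: \<E>_def)
  show ?thesis
  proof (rule that[OF F])
    fix v assume v: "v \<in> delta1 p" "v (\<Inter>\<E>) = u (\<Inter>\<E>)"
    have uv: "u \<in> Xtilde p" "v \<in> Xtilde p"
      using v S(2) assms(2) by (auto simp: delta1_iff)
    have "v E \<in> U E" if E: "E \<in> entourages" for E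
    proof (cases "E \<in> \<E>")
      case True
      then have "\<Inter>\<E> \<subseteq> E" by blast
      from Xtilde_eq_mono[OF uv(2,1) E F this v(2)] show ?thesis
        using U(2) E by auto
    next
      case False
      then show ?thesis
        using v(1) E by (auto simp: \<E>_def delta1_def inverse_limit_def)
    qed
    then have "v \<in> Pi\<^sub>E entourages U"
      using v(1) by (auto simp: delta1_def inverse_limit_def PiE_iff)
    then show "v \<in> T"
      using U(3) S(2) v(1) by blast
  qed
qed

lemma lambda_hom_image_dense:
  fixes p :: "'a::uniform_space"
  assumes "uniformly_locally_path_connected TYPE('a)"
  shows "delta1_top p closure_of (lambda_hom p ` fundamental_group p) = delta1 p"
proof
  show "delta1_top p closure_of (lambda_hom p ` fundamental_group p) \<subseteq> delta1 p"
    using closure_of_subset_topspace topspace_delta1_top by metis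
  show "delta1 p \<subseteq> delta1_top p closure_of (lambda_hom p ` fundamental_group p)"
  proof
    fix u assume u: "u \<in> delta1 p"
    then have uX: "u \<in> Xtilde p" "Xtilde_proj u = p"
      by (simp_all add: delta1_iff)
    have "\<exists>v. v \<in> lambda_hom p ` fundamental_group p \<and> v \<in> T"
      if T: "u \<in> T" "openin (delta1_top p) T" for T
    proof -
      obtain E where E: "E \<in> entourages" "\<And>v. v \<in> delta1 p \<Longrightarrow> v E = u E \<Longrightarrow> v \<in> T"
        using delta1_neighbourhood[OF T(2,1)] by blast
      obtain F where F: "F \<in> entourages" "F \<subseteq> E" "\<And>x. path_connected (eball x F)"
        using assms E(1) unfolding uniformly_locally_path_connected_def by blast
      obtain \<alpha> where \<alpha>: "chain F \<alpha>" "hd \<alpha> = p" "u F = chain_class F \<alpha>"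
        using Xtilde_repr[OF uX(1) F(1)] .
      have last: "last \<alpha> = p"
        using Xtilde_proj_eq[OF uX(1) F(1), of \<alpha>] uX(2) \<alpha>(3) chain_homotopy_refl[OF \<alpha>(1)] by simp
      obtain c where c: "path c" "c 0 = p" "c 1 = p" "lift_path p c 1 F = chain_class F \<alpha>"
        using path_lifting_to_chain[OF F(1,3) \<alpha>(1,2)] last by metis
      note c' = c(1)[unfolded path_def] c(2)
      define v where "v = lift_path p c 1"
      have v: "v \<in> Xtilde p"
        unfolding v_def by (rule lift_path_Xtilde[OF c']) simp
      have vF: "v F = u F"
        by (simp add: v_def c(4) \<alpha>(3))
      have "\<alpha> \<in> v F"
        using vF \<alpha>(1,3) chain_homotopy_refl by simp
      from Xtilde_proj_eq[OF v F(1) this] have "v \<in> delta1 p"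
        using v last by (simp add: delta1_iff)
      moreover have "v E = u E"
        by (rule Xtilde_eq_mono[OF v uX(1) E(1) F(1,2) vF])
      ultimately have "v \<in> T"
        by (rule E(2))
      moreover have "{(c, d). homotopic_paths UNIV c d} `` {c} \<in> fundamental_group p"
        unfolding fundamental_group_def
        by (rule quotientI) (use c in \<open>simp add: pathstart_def pathfinish_def\<close>)
      then have "v \<in> lambda_hom p ` fundamental_group p"
        unfolding v_def using lambda_hom_eq[OF c(1,2)] by (metis image_eqI)
      ultimately show ?thesis by blast
    qed
    with u show "u \<in> delta1_top p closure_of (lambda_hom p ` fundamental_group p)"
      by (simp add: in_closure_of topspace_delta1_top)
  qed
qed

theorem proposition79:
  fixes p :: "'a::uniform_space"
  assumes "uniformly_locally_path_connected TYPE('a)"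
    and "connected (UNIV :: 'a set)"
  shows "Xtilde_top p closure_of path_component_of_set (Xtilde_top p) (Xtilde_base p) = Xtilde p
       \<and> delta1_top p closure_of (lambda_hom p ` fundamental_group p) = delta1 p"
  using Xtilde_basepoint_component_dense[OF assms(1)] lambda_hom_image_dense[OF assms(1)] ..

end
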